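(* Let $(\mathcal{X},d)$ be a finite metric space with arrival rates $\lambda_x>0$ and let $p>0$. For MPMDfp (MPMD with penalty $p$ for clearing a request) in the Poisson arrival model, the algorithm $\mathrm{ALG}$ described in the context achieves a ratio of expectations of $8/(1-e^{-2})$, i.e. $\limsup_{m\to\infty}\mathbb{E}^m_\sigma[\mathrm{ALG}(\sigma)]/\mathbb{E}^m_\sigma[\mathrm{OPT}(\sigma)]\le 8/(1-e^{-2})$.
   Context: MPMDfp on a finite metric space $(\mathcal{X},d)$: input is a sequence $\sigma$ of $m$ requests, each with location $\ell(r)\in\mathcal{X}$ and distinct arrival time $t(r)\ge0$. Each request must either be matched with another request at some time $s(r)\ge t(r)$ (equal for both members of the pair), incurring connection cost $d(\ell(r),\ell(r'))$ per pair and delay cost $s(r)-t(r)$ per request, or be cleared at a penalty cost $p$. The total cost is the sum of connection, delay and penalty costs; online decisions use only requests arrived so far and are irrevocable; $\mathrm{OPT}(\sigma)$ is the minimum offline cost. Poisson arrival model: waiting times between consecutive requests are i.i.d. exponential with parameter $\lambda(\mathcal{X})=\sum_x\lambda_x$, each request is at $x$ independently with probability $\lambda_x/\lambda(\mathcal{X})$, independent of waiting times; $\mathbb{E}^m_\sigma$ is expectation over a random sequence of $m$ such requests. For $S\subseteq\mathcal{X}$, $\lambda(S)=\sum_{x\in S}\lambda_x$; $\overline{B}(x,u)=\{y:d(x,y)\le u\}$; the radius $\rho_x$ is the minimum $u\ge0$ with $1/\lambda(\overline{B}(x,u))\le u$. Let $\mathcal{X}^{(1)}=\{x:\rho_x<p\}$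 and $\mathcal{X}^{(2)}=\{x:\rho_x\ge p\}$. Algorithm $\mathrm{ALG}$: when a request $r$ arrives at $x=\ell(r)$: if $x\in\mathcal{X}^{(2)}$, then if there is a pending request $r'$ at a point $y\in\mathcal{X}^{(1)}$ with $x\in\overline{B}(y,\rho_y)$, match $r$ with $r'$, otherwise clear $r$; if $x\in\mathcal{X}^{(1)}$, process $r$ by the Radius rule: if some pending $r'$ has $d(x,\ell(r'))\le\rho_{\ell(r')}$, match them; else if some pending $r'$ has $d(x,\ell(r'))\le\rho_{\ell(r')}+\rho_x$, match them (ties arbitrary); otherwise $r$ becomes pending. At the arrival of the last request, the remaining pending requests are matched arbitrarily, and if their number is odd the last request is cleared. *)

theory Defs
  imports "HOL-Probability.Probability"
begin

text \<open>The finite metric space is a type of class \<^class>\<open>finite\<close> and \<^class>\<open>metric_space\<close>. A request is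
  a pair of a location and an arrival time; in an input sequence \<open>\<sigma>\<close> requests are identified
  by their positions \<open>0, \<dots>, length \<sigma> - 1\<close>, in the order of arrival.\<close>

type_synonym 'a request = "'a \<times> real"

definition loc :: "'a request list \<Rightarrow> nat \<Rightarrow> 'a" where
  "loc \<sigma> i = fst (\<sigma> ! i)"

definition arr :: "'a request list \<Rightarrow> nat \<Rightarrow> real" where
  "arr \<sigma> i = snd (\<sigma> ! i)"

subsection \<open>Offline solutions\<close>

text \<open>A solution is a set of triples \<open>(i, j, \<tau>)\<close>: requests \<open>i\<close> and \<open>j\<close> are matched with each other
  at time \<open>\<tau>\<close>, which is the common value \<open>s(i) = s(j)\<close>. All requests occurring in no triple are
  cleared.\<close>

type_synonym solution = "(nat \<times> nat \<times> real) set"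

definition matched :: "solution \<Rightarrow> nat set" where
  "matched A = (\<Union>(i, j, \<tau>)\<in>A. {i, j})"

definition feasible :: "'a request list \<Rightarrow> solution \<Rightarrow> bool" where
  "feasible \<sigma> A \<longleftrightarrow>
     (\<forall>(i, j, \<tau>)\<in>A. i < length \<sigma> \<and> j < length \<sigma> \<and> i \<noteq> j \<and> arr \<sigma> i \<le> \<tau> \<and> arr \<sigma> j \<le> \<tau>) \<and>
     pairwise (\<lambda>(i, j, \<tau>) (i', j', \<tau>'). {i, j} \<inter> {i', j'} = {}) A"

definition cost :: "real \<Rightarrow> 'a::metric_space request list \<Rightarrow> solution \<Rightarrow> real" where
  "cost p \<sigma> A =
     (\<Sum>(i, j, \<tau>)\<in>A. dist (loc \<sigma> i) (loc \<sigma> j) + (\<tau> - arr \<sigma> i) + (\<tau> - arr \<sigma> j)) +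
     p * real (card ({..<length \<sigma>} - matched A))"

definition opt :: "real \<Rightarrow> 'a::metric_space request list \<Rightarrow> real" where
  "opt p \<sigma> = Inf {cost p \<sigma> A | A. feasible \<sigma> A}"

subsection \<open>Poisson arrivals\<close>

definition total_rate :: "('a::finite \<Rightarrow> real) \<Rightarrow> real" where
  "total_rate rate = sum rate UNIV"

definition location_pmf :: "('a::finite \<Rightarrow> real) \<Rightarrow> 'a pmf" where
  "location_pmf rate = embed_pmf (\<lambda>x. rate x / total_rate rate)"

text \<open>The \<open>i\<close>-th coordinate is the location of request \<open>i\<close> together with the waiting time that
  precedes it.\<close>

definition poisson_measure :: "('a::finite \<Rightarrow> real) \<Rightarrow> nat \<Rightarrow> (nat \<Rightarrow> 'a \<times> real) measure" where
  "poisson_measure rate m =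
     (\<Pi>\<^sub>M i\<in>{..<m}. measure_pmf (location_pmf rate) \<Otimes>\<^sub>M
        density lborel (\<lambda>w. ennreal (exponential_density (total_rate rate) w)))"

definition request_seq :: "nat \<Rightarrow> (nat \<Rightarrow> 'a \<times> real) \<Rightarrow> 'a request list" where
  "request_seq m \<omega> = map (\<lambda>i. (fst (\<omega> i), \<Sum>j\<le>i. snd (\<omega> j))) [0..<m]"

definition poisson_expectation ::
    "('a::finite \<Rightarrow> real) \<Rightarrow> nat \<Rightarrow> ('a request list \<Rightarrow> real) \<Rightarrow> ennreal" where
  "poisson_expectation rate m F =
     (\<integral>\<^sup>+\<omega>. ennreal (F (request_seq m \<omega>)) \<partial>poisson_measure rate m)"

subsection \<open>The algorithm\<close>

definition radius :: "('a::{finite, metric_space} \<Rightarrow> real) \<Rightarrow> 'a \<Rightarrow> real" where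
  "radius rate x = Inf {u. 0 \<le> u \<and> 1 / sum rate (cball x u) \<le> u}"

definition points1 :: "('a::{finite, metric_space} \<Rightarrow> real) \<Rightarrow> real \<Rightarrow> 'a set" where
  "points1 rate p = {x. radius rate x < p}"

definition points2 :: "('a::{finite, metric_space} \<Rightarrow> real) \<Rightarrow> real \<Rightarrow> 'a set" where
  "points2 rate p = {x. radius rate x \<ge> p}"

text \<open>The arbitrary choices of the algorithm are parameters. A tie rule picks one element of a set of
  candidate partners, knowing the requests that have arrived so far; a final rule matches up the
  requests that are pending in the end, leaving out one of them iff their number is odd.\<close>

definition tie_rule :: "('a request list \<Rightarrow> nat set \<Rightarrow> nat) \<Rightarrow> bool" where
  "tie_rule tie \<longleftrightarrow> (\<forall>h C. finite C \<and> C \<noteq> {} \<longrightarrow> tie h C \<in> C)"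

definition final_rule :: "('a request list \<Rightarrow> nat set \<Rightarrow> (nat \<times> nat) set) \<Rightarrow> bool" where
  "final_rule fin \<longleftrightarrow> (\<forall>\<sigma> P. finite P \<longrightarrow>
     (\<forall>(i, j)\<in>fin \<sigma> P. i \<in> P \<and> j \<in> P \<and> i \<noteq> j) \<and>
     pairwise (\<lambda>(i, j) (i', j'). {i, j} \<inter> {i', j'} = {}) (fin \<sigma> P) \<and>
     card (P - (\<Union>(i, j)\<in>fin \<sigma> P. {i, j})) = card P mod 2)"

text \<open>The pending requests \<open>P\<close> with which request \<open>k\<close> may be matched on its arrival.\<close>

definition candidates :: "('a::{finite, metric_space} \<Rightarrow> real) \<Rightarrow> real \<Rightarrow> 'a request list \<Rightarrow>
    nat \<Rightarrow> nat set \<Rightarrow> nat set" where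
  "candidates rate p \<sigma> k P =
     (let x = loc \<sigma> k;
          C1 = {i \<in> P. dist x (loc \<sigma> i) \<le> radius rate (loc \<sigma> i)};
          C2 = {i \<in> P. dist x (loc \<sigma> i) \<le> radius rate (loc \<sigma> i) + radius rate x}
      in if x \<in> points2 rate p
         then {i \<in> P. loc \<sigma> i \<in> points1 rate p \<and> x \<in> cball (loc \<sigma> i) (radius rate (loc \<sigma> i))}
         else if C1 \<noteq> {} then C1 else C2)"

text \<open>\<open>alg_state rate p tie \<sigma> k\<close> consists of the pending requests and the matches made so far, after
  the first \<open>k\<close> requests have been processed.\<close>

primrec alg_state :: "('a::{finite, metric_space} \<Rightarrow> real) \<Rightarrow> real \<Rightarrow>
    ('a request list \<Rightarrow> nat set \<Rightarrow> nat) \<Rightarrow> 'a request list \<Rightarrow> nat \<Rightarrow> nat set \<times> solution" where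
  "alg_state rate p tie \<sigma> 0 = ({}, {})"
| "alg_state rate p tie \<sigma> (Suc k) =
     (let (P, A) = alg_state rate p tie \<sigma> k;
          C = candidates rate p \<sigma> k P;
          i = tie (take (Suc k) \<sigma>) C
      in if C \<noteq> {} then (P - {i}, insert (i, k, arr \<sigma> k) A)
         else if loc \<sigma> k \<in> points2 rate p then (P, A)
         else (insert k P, A))"

definition alg_solution :: "('a::{finite, metric_space} \<Rightarrow> real) \<Rightarrow> real \<Rightarrow>
    ('a request list \<Rightarrow> nat set \<Rightarrow> nat) \<Rightarrow> ('a request list \<Rightarrow> nat set \<Rightarrow> (nat \<times> nat) set) \<Rightarrow>
    'a request list \<Rightarrow> solution" where
  "alg_solution rate p tie fin \<sigma> =
     (let (P, A) = alg_state rate p tie \<sigma> (length \<sigma>)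
      in A \<union> (\<lambda>(i, j). (i, j, arr \<sigma> (length \<sigma> - 1))) ` fin \<sigma> P)"

definition alg :: "('a::{finite, metric_space} \<Rightarrow> real) \<Rightarrow> real \<Rightarrow>
    ('a request list \<Rightarrow> nat set \<Rightarrow> nat) \<Rightarrow> ('a request list \<Rightarrow> nat set \<Rightarrow> (nat \<times> nat) set) \<Rightarrow>
    'a request list \<Rightarrow> real" where
  "alg rate p tie fin \<sigma> = cost p \<sigma> (alg_solution rate p tie fin \<sigma>)"

subsection \<open>Well-definedness\<close>

lemma pmf_location_pmf:
  fixes rate :: "'a::finite \<Rightarrow> real"
  assumes "\<And>x. 0 < rate x"
  shows "pmf (location_pmf rate) x = rate x / total_rate rate"
proof -
  have pos: "0 < total_rate rate"
    unfolding total_rate_def using assms by (intro sum_pos) auto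
  have nn: "0 \<le> rate x / total_rate rate" for x
    using assms[of x] pos by simp
  have "(\<integral>\<^sup>+x. ennreal (rate x / total_rate rate) \<partial>count_space UNIV) =
      (\<Sum>x\<in>UNIV. ennreal (rate x / total_rate rate))"
    by (rule nn_integral_count_space_finite) simp
  also have "\<dots> = ennreal (\<Sum>x\<in>UNIV. rate x / total_rate rate)"
    using nn by (intro sum_ennreal) auto
  also have "(\<Sum>x\<in>UNIV. rate x / total_rate rate) = 1"
    using pos by (simp add: total_rate_def flip: sum_divide_distrib)
  finally show ?thesis
    unfolding location_pmf_def using nn by (intro pmf_embed_pmf) simp_all
qed

text \<open>The infima in the definitions of the radius and of the offline optimum are minima.\<close>

lemma radius_minimum:
  fixes rate :: "'a::{finite, metric_space} \<Rightarrow> real"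
  assumes "\<And>x. 0 < rate x"
  shows "0 \<le> radius rate x" "1 / sum rate (cball x (radius rate x)) \<le> radius rate x"
    and "0 \<le> u \<Longrightarrow> 1 / sum rate (cball x u) \<le> u \<Longrightarrow> radius rate x \<le> u"
proof -
  define U where "U = {u. 0 \<le> u \<and> 1 / sum rate (cball x u) \<le> u}"
  have R: "radius rate x = Inf U"
    by (simp add: radius_def U_def)
  have fin: "finite S" for S :: "'a set" by simp
  have pos: "0 < sum rate (cball x u)" if "0 \<le> u" for u
    using that assms by (intro sum_pos fin) auto
  have mono: "sum rate (cball x u) \<le> sum rate (cball x v)" if "u \<le> v" for u v
    using that assms by (intro sum_mono2 fin) (auto simp: less_imp_le)
  have bdd: "bdd_below U"
    unfolding U_def by (rule bdd_belowI[of _ 0]) auto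
  have ne: "U \<noteq> {}"
  proof -
    let ?u = "1 / sum rate (cball x 0)"
    have "0 \<le> ?u" using pos[of 0] by simp
    moreover have "1 / sum rate (cball x ?u) \<le> ?u"
      using pos[of 0] mono[OF \<open>0 \<le> ?u\<close>] by (intro divide_left_mono mult_pos_pos pos \<open>0 \<le> ?u\<close>) auto
    ultimately have "?u \<in> U" unfolding U_def by blast
    then show ?thesis by blast
  qed
  show nn: "0 \<le> radius rate x"
    unfolding R using ne by (intro cInf_greatest) (auto simp: U_def)
  show "0 \<le> u \<Longrightarrow> 1 / sum rate (cball x u) \<le> u \<Longrightarrow> radius rate x \<le> u"
    unfolding R using bdd by (intro cInf_lower) (auto simp: U_def)
  show "1 / sum rate (cball x (radius rate x)) \<le> radius rate x"
  proof (rule field_le_epsilon)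
    fix e :: real assume "0 < e"
    define r where "r = radius rate x"
    define D where "D = {dist x y | y. r < dist x y}"
    have "finite D" unfolding D_def by simp
    define v where "v = Min (insert (r + e) D)"
    have "r < v" unfolding v_def using \<open>finite D\<close> \<open>0 < e\<close> by (auto simp: D_def)
    then obtain u where u: "u \<in> U" "u < v"
      using cInf_lessD[OF ne, of v] by (auto simp: R r_def)
    have "v \<le> r + e" unfolding v_def using \<open>finite D\<close> by (intro Min_le) auto
    have "cball x u \<subseteq> cball x r"
    proof
      fix y assume y: "y \<in> cball x u"
      show "y \<in> cball x r"
      proof (rule ccontr)
        assume "y \<notin> cball x r"
        then have "dist x y \<in> D" by (auto simp: D_def)
        then have "v \<le> dist x y" unfolding v_def using \<open>finite D\<close> by (intro Min_le) auto
        then show False using y u by auto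
      qed
    qed
    then have "sum rate (cball x u) \<le> sum rate (cball x r)"
      using assms by (intro sum_mono2 fin) (auto simp: less_imp_le)
    then have "1 / sum rate (cball x r) \<le> 1 / sum rate (cball x u)"
      using pos[of u] u nn by (intro divide_left_mono mult_pos_pos pos) (auto simp: U_def r_def)
    also have "\<dots> \<le> r + e" using u \<open>v \<le> r + e\<close> by (auto simp: U_def)
    finally show "1 / sum rate (cball x (radius rate x)) \<le> radius rate x + e"
      by (simp add: r_def)
  qed
qed

lemma opt_minimum:
  fixes \<sigma> :: "'a::metric_space request list"
  shows "\<exists>A. feasible \<sigma> A \<and> opt p \<sigma> = cost p \<sigma> A \<and> (\<forall>B. feasible \<sigma> B \<longrightarrow> cost p \<sigma> A \<le> cost p \<sigma> B)"
proof -
  define f where "f = (\<lambda>(i, j, \<tau>::real). (i, j, max (arr \<sigma> i) (arr \<sigma> j)))"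
  define G where "G = (\<lambda>(i, j). (i, j, max (arr \<sigma> i) (arr \<sigma> j))) ` ({..<length \<sigma>} \<times> {..<length \<sigma>})"
  define F where "F = {A \<in> Pow G. feasible \<sigma> A}"
  have "finite F" unfolding F_def G_def by simp
  have "{} \<in> F" unfolding F_def feasible_def by simp
  have better: "\<exists>A\<in>F. cost p \<sigma> A \<le> cost p \<sigma> B" if B: "feasible \<sigma> B" for B
  proof (rule bexI[of _ "f ` B"])
    have Bd: "i < length \<sigma>" "j < length \<sigma>" "i \<noteq> j" "arr \<sigma> i \<le> \<tau>" "arr \<sigma> j \<le> \<tau>"
      if "(i, j, \<tau>) \<in> B" for i j \<tau>
      using B that by (auto simp: feasible_def)
    have dj: "{i, j} \<inter> {i', j'} = {}"
      if "(i, j, \<tau>) \<in> B" "(i', j', \<tau>') \<in> B" "(i, j, \<tau>) \<noteq> (i', j', \<tau>')" for i j \<tau> i' j' \<tau>'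
      using pairwiseD[OF conjunct2[OF B[unfolded feasible_def]] that] by simp
    have inj: "inj_on f B"
    proof (rule inj_onI)
      fix a b assume ab: "a \<in> B" "b \<in> B" "f a = f b"
      obtain i j \<tau> where a: "a = (i, j, \<tau>)" by (cases a)
      obtain i' j' \<tau>' where b: "b = (i', j', \<tau>')" by (cases b)
      show "a = b" using ab dj[of i j \<tau> i' j' \<tau>'] unfolding a b f_def by auto
    qed
    show "f ` B \<in> F"
      unfolding F_def
    proof (intro CollectI conjI PowI)
      show "f ` B \<subseteq> G"
        using Bd by (fastforce simp: f_def G_def)
      show "feasible \<sigma> (f ` B)"
        unfolding feasible_def
      proof (intro conjI pairwiseI)
        show "\<forall>(i, j, \<tau>)\<in>f ` B. i < length \<sigma> \<and> j < length \<sigma> \<and> i \<noteq> j \<and> arr \<sigma> i \<le> \<tau> \<and> arr \<sigma> j \<le> \<tau>"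
          using Bd by (fastforce simp: f_def)
        fix a b assume "a \<in> f ` B" "b \<in> f ` B" "a \<noteq> b"
        then obtain i j \<tau> i' j' \<tau>' where *: "(i, j, \<tau>) \<in> B" "a = f (i, j, \<tau>)"
          "(i', j', \<tau>') \<in> B" "b = f (i', j', \<tau>')" by force
        with \<open>a \<noteq> b\<close> have "(i, j, \<tau>) \<noteq> (i', j', \<tau>')" by auto
        from dj[OF *(1) *(3) this]
        show "(case a of (i, j, \<tau>) \<Rightarrow> \<lambda>(i', j', \<tau>'). {i, j} \<inter> {i', j'} = {}) b"
          by (simp add: * f_def)
      qed
    qed
    have m: "matched (f ` B) = matched B"
      by (simp add: matched_def f_def case_prod_beta)
    show "cost p \<sigma> (f ` B) \<le> cost p \<sigma> B"
      unfolding cost_def m sum.reindex[OF inj]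
      using Bd by (intro add_mono sum_mono order_refl) (fastforce simp: f_def)
  qed
  define c where "c = Min (cost p \<sigma> ` F)"
  have "c \<in> cost p \<sigma> ` F"
    unfolding c_def using \<open>finite F\<close> \<open>{} \<in> F\<close> by (intro Min_in) auto
  then obtain A where A: "A \<in> F" "c = cost p \<sigma> A" by auto
  have fA: "feasible \<sigma> A" using A by (simp add: F_def)
  have le: "cost p \<sigma> A \<le> cost p \<sigma> B" if B: "feasible \<sigma> B" for B
  proof -
    obtain A' where "A' \<in> F" "cost p \<sigma> A' \<le> cost p \<sigma> B" using better[OF B] by blast
    moreover have "c \<le> cost p \<sigma> A'"
      unfolding c_def using \<open>finite F\<close> \<open>A' \<in> F\<close> by (intro Min_le) auto
    ultimately show ?thesis using A by simp
  qed
  have "opt p \<sigma> = cost p \<sigma> A"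
    unfolding opt_def using fA le by (intro cInf_eq_minimum) auto
  with fA le show ?thesis by blast
qed

end

theory Submission
  imports Defs
begin

text \<open>Write \<open>r\<^sub>x\<close> for the minimum of the radius \<open>\<rho>\<^sub>x\<close> and \<open>p\<close>, and \<open>s\<close> for the mean of \<open>r\<^sub>x\<close> over
  the location distribution.

  Upper bound: the balls around pending requests are disjoint, so an arrival in such a ball is
  matched with its centre whatever the tie rule does. Hence a request at \<open>x\<close> waits at most until
  the next arrival in its ball, on average \<open>1 / \<lambda>(B(x, \<rho>\<^sub>x)) \<le> \<rho>\<^sub>x\<close>, and charging \<open>\<rho>\<^sub>x\<close> for
  the connection and this delay to each request in the first class, and \<open>p\<close> to each request in the
  second, pays for everything except a bounded amount at the end: the expected cost is at most
  \<open>2 s m + C\<close>. The charges are measurable even when the tie rule is not.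

  Lower bound: every solution pays, for each request, at least half of the minimum of \<open>p\<close> and the
  space-time distance to the closest other request. This minimum exceeds \<open>u < r\<^sub>x\<close> if there is no
  arrival in the open ball of radius \<open>r\<^sub>x\<close> within time \<open>u\<close> before or after, which has probability at
  least \<open>exp (- 2 u / r\<^sub>x)\<close>, because the rate of that ball is at most \<open>1 / r\<^sub>x\<close>. Integrating over
  \<open>u\<close>, the expected optimum is at least \<open>m s (1 - exp (- 2)) / 4\<close>.\<close>

section \<open>Pathwise bounds\<close>

lemma sum_matched:
  fixes A :: solution and g :: "nat \<Rightarrow> real"
  assumes "finite A" "\<forall>(i, j, \<tau>)\<in>A. i \<noteq> j"
    and "pairwise (\<lambda>(i, j, \<tau>) (i', j', \<tau>'). {i, j} \<inter> {i', j'} = {}) A"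
  shows "(\<Sum>(i, j, \<tau>)\<in>A. g i + g j) = sum g (matched A)"
proof -
  have "sum g (matched A) = (\<Sum>a\<in>A. sum g (case a of (i, j, \<tau>) \<Rightarrow> {i, j}))"
    unfolding matched_def
  proof (rule sum.UNION_disjoint)
    show "\<forall>a\<in>A. \<forall>b\<in>A. a \<noteq> b \<longrightarrow>
        (case a of (i, j, \<tau>) \<Rightarrow> {i, j}) \<inter> (case b of (i, j, \<tau>) \<Rightarrow> {i, j}) = {}"
      using assms(3) unfolding pairwise_def by fast
  qed (use assms(1) in auto)
  also have "\<dots> = (\<Sum>(i, j, \<tau>)\<in>A. g i + g j)"
    using assms(2) by (intro sum.cong) auto
  finally show ?thesis by simp
qed

lemma matched_subset: "feasible \<sigma> A \<Longrightarrow> matched A \<subseteq> {..<length \<sigma>}"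
  by (auto simp: feasible_def matched_def)

text \<open>Matching times are reals, so finiteness needs an argument: pairs of different triples
  are disjoint, hence a triple is determined by its first request.\<close>

lemma feasible_finite:
  assumes "feasible \<sigma> A"
  shows "finite A"
proof (rule inj_on_finite[of fst])
  show "inj_on fst A"
  proof (rule inj_onI, rule ccontr)
    fix a b assume ab: "a \<in> A" "b \<in> A" "fst a = fst b" "a \<noteq> b"
    from pairwiseD[OF conjunct2[OF assms[unfolded feasible_def]] ab(1,2,4)] ab(3)
    show False by (cases a, cases b) auto
  qed
  show "fst ` A \<subseteq> {..<length \<sigma>}"
    using assms unfolding feasible_def by auto
qed simp

text \<open>\<open>Z i\<close> bounds both ways of serving request \<open>i\<close>. A pair matched
  at \<open>\<tau>\<close> pays at least its distance plus the difference of its arrival times,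
  because \<open>\<tau>\<close> precedes neither arrival; half of that goes to each member. Clearing
  pays \<open>p\<close>, which is at least \<open>Z i / 2\<close>.\<close>

lemma opt_lower:
  fixes \<sigma> :: "'a::metric_space request list"
  assumes "0 \<le> p" and Zp: "\<And>i. i < length \<sigma> \<Longrightarrow> Z i \<le> p"
    and Zd: "\<And>i j. i < length \<sigma> \<Longrightarrow> j < length \<sigma> \<Longrightarrow> i \<noteq> j \<Longrightarrow>
      Z i \<le> dist (loc \<sigma> i) (loc \<sigma> j) + \<bar>arr \<sigma> i - arr \<sigma> j\<bar>"
  shows "(\<Sum>i<length \<sigma>. Z i / 2) \<le> opt p \<sigma>"
proof -
  obtain A where A: "feasible \<sigma> A" "opt p \<sigma> = cost p \<sigma> A"
    using opt_minimum by blast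
  have f: "finite A" using A feasible_finite by blast
  let ?U = "{..<length \<sigma>} - matched A"
  have "(\<Sum>i<length \<sigma>. Z i / 2) = (\<Sum>i\<in>matched A. Z i / 2) + (\<Sum>i\<in>?U. Z i / 2)"
    by (metis A(1) add.commute finite_lessThan matched_subset sum.subset_diff)
  also have "(\<Sum>i\<in>matched A. Z i / 2) = (\<Sum>(i, j, \<tau>)\<in>A. Z i / 2 + Z j / 2)"
    using A f by (intro sum_matched[symmetric]) (auto simp: feasible_def)
  also have "\<dots> \<le> (\<Sum>(i, j, \<tau>)\<in>A. dist (loc \<sigma> i) (loc \<sigma> j) + (\<tau> - arr \<sigma> i) + (\<tau> - arr \<sigma> j))"
  proof (rule sum_mono, clarify)
    fix i j \<tau> assume "(i, j, \<tau>) \<in> A"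
    then have *: "i < length \<sigma>" "j < length \<sigma>" "i \<noteq> j" "arr \<sigma> i \<le> \<tau>" "arr \<sigma> j \<le> \<tau>"
      using A by (auto simp: feasible_def)
    show "Z i / 2 + Z j / 2 \<le> dist (loc \<sigma> i) (loc \<sigma> j) + (\<tau> - arr \<sigma> i) + (\<tau> - arr \<sigma> j)"
      using Zd[of i j] Zd[of j i] * dist_commute[of "loc \<sigma> i" "loc \<sigma> j"] by simp
  qed
  also have "(\<Sum>i\<in>?U. Z i / 2) \<le> (\<Sum>i\<in>?U. p)"
    using Zp \<open>0 \<le> p\<close> by (intro sum_mono) force
  finally show ?thesis
    unfolding A(2) cost_def by (simp add: mult.commute)
qed

section \<open>The cost of the algorithm along a fixed arrival sequence\<close>

text \<open>The delay of request \<open>i\<close> until the next arrival in its ball, cut off at the last arrival.\<close>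

definition wait :: "('a::{finite, metric_space} \<Rightarrow> real) \<Rightarrow> 'a request list \<Rightarrow> nat \<Rightarrow> real" where
  "wait rate \<sigma> i = (\<Sum>k\<in>{i<..<length \<sigma>}.
     if \<forall>j\<in>{i<..<k}. loc \<sigma> j \<notin> cball (loc \<sigma> i) (radius rate (loc \<sigma> i))
     then arr \<sigma> k - arr \<sigma> (k - 1) else 0)"

text \<open>It depends on the arrival sequence alone, not on the choices of the algorithm. In the
  second class \<open>p\<close> is charged whether the request ends up cleared or matched.\<close>

definition charge :: "('a::{finite, metric_space} \<Rightarrow> real) \<Rightarrow> real \<Rightarrow> 'a request list \<Rightarrow> nat \<Rightarrow> real"
    where
  "charge rate p \<sigma> i =
     (if loc \<sigma> i \<in> points2 rate p then p else radius rate (loc \<sigma> i) + wait rate \<sigma> i)"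

definition chronological :: "'a request list \<Rightarrow> bool" where
  "chronological \<sigma> \<longleftrightarrow> (\<forall>k. Suc k < length \<sigma> \<longrightarrow> arr \<sigma> k \<le> arr \<sigma> (Suc k))"

lemma chronologicalD:
  assumes "chronological \<sigma>" "i < k" "k < length \<sigma>"
  shows "arr \<sigma> (k - 1) \<le> arr \<sigma> k"
  using assms by (cases k) (auto simp: chronological_def)

lemma wait_nonneg: "chronological \<sigma> \<Longrightarrow> 0 \<le> wait rate \<sigma> i"
  unfolding wait_def by (intro sum_nonneg) (auto dest: chronologicalD)

text \<open>The delay telescopes into gaps between consecutive arrivals, and \<open>wait\<close>
  counts all of these, since no request strictly between \<open>i\<close> and \<open>k\<close> lies
  in the ball. Request \<open>k\<close> itself may lie there: it ends the wait. The other terms of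
  \<open>wait\<close> are nonnegative.\<close>

lemma delay_le_wait:
  assumes \<sigma>: "chronological \<sigma>" and "i \<le> k" "k < length \<sigma>"
    and free: "\<forall>j\<in>{i<..<k}. loc \<sigma> j \<notin> cball (loc \<sigma> i) (radius rate (loc \<sigma> i))"
  shows "arr \<sigma> k - arr \<sigma> i \<le> wait rate \<sigma> i"
proof -
  have "arr \<sigma> k - arr \<sigma> i = (\<Sum>l\<in>{i<..k}. arr \<sigma> l - arr \<sigma> (l - 1))"
    using \<open>i \<le> k\<close>
  proof (induction k rule: dec_induct)
    case (step n)
    have "{i<..Suc n} = insert (Suc n) {i<..n}" using step by auto
    then show ?case using step by simp
  qed simp
  also have "\<dots> = (\<Sum>l\<in>{i<..k}.
     if \<forall>j\<in>{i<..<l}. loc \<sigma> j \<notin> cball (loc \<sigma> i) (radius rate (loc \<sigma> i))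
     then arr \<sigma> l - arr \<sigma> (l - 1) else 0)"
    using free by (intro sum.cong) auto
  also have "\<dots> \<le> wait rate \<sigma> i"
    unfolding wait_def using assms by (intro sum_mono2) (auto dest: chronologicalD)
  finally show ?thesis .
qed

text \<open>Induction over the arrivals. A request becomes pending only if its ball is disjoint from
  all pending balls, so these stay disjoint and a request that hits one of them is matched with its
  centre. Hence no pending ball has been hit since its centre arrived, which bounds the delay at a
  match by \<open>wait\<close>. Requests that are no longer pending pay for all costs so far;
  pending ones have not been charged yet.\<close>

lemma alg_state_invariant:
  fixes \<sigma> :: "'a::{finite, metric_space} request list"
  assumes rate: "\<And>x. 0 < rate x" and p: "0 < p" and tie: "tie_rule tie" and \<sigma>: "chronological \<sigma>"
    and k: "k \<le> length \<sigma>" and st: "alg_state rate p tie \<sigma> k = (P, A)"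
  shows "P \<subseteq> {..<k} \<and> (\<forall>i\<in>P. loc \<sigma> i \<in> points1 rate p) \<and>
    (\<forall>i\<in>P. \<forall>j\<in>P. i \<noteq> j \<longrightarrow>
       radius rate (loc \<sigma> i) + radius rate (loc \<sigma> j) < dist (loc \<sigma> i) (loc \<sigma> j)) \<and>
    (\<forall>i\<in>P. \<forall>j\<in>{i<..<k}. loc \<sigma> j \<notin> cball (loc \<sigma> i) (radius rate (loc \<sigma> i))) \<and>
    finite A \<and> matched A \<subseteq> {..<k} - P \<and>
    (\<Sum>(i, j, \<tau>)\<in>A. dist (loc \<sigma> i) (loc \<sigma> j) + (\<tau> - arr \<sigma> i) + (\<tau> - arr \<sigma> j)) +
      p * real (card ({..<k} - P - matched A)) \<le> (\<Sum>i\<in>{..<k} - P. charge rate p \<sigma> i)"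
  using k st
proof (induction k arbitrary: P A)
  case 0
  then show ?case by (simp add: matched_def)
next
  case (Suc k)
  obtain P0 A0 where st0: "alg_state rate p tie \<sigma> k = (P0, A0)" by force
  note IH = Suc.IH[OF _ st0]
  have k: "k < length \<sigma>" using Suc.prems by simp
  have P0: "P0 \<subseteq> {..<k}" "\<And>i. i \<in> P0 \<Longrightarrow> loc \<sigma> i \<in> points1 rate p"
    and far: "\<And>i j. i \<in> P0 \<Longrightarrow> j \<in> P0 \<Longrightarrow> i \<noteq> j \<Longrightarrow>
       radius rate (loc \<sigma> i) + radius rate (loc \<sigma> j) < dist (loc \<sigma> i) (loc \<sigma> j)"
    and free: "\<And>i j. i \<in> P0 \<Longrightarrow> i < j \<Longrightarrow> j < k \<Longrightarrow>
       loc \<sigma> j \<notin> cball (loc \<sigma> i) (radius rate (loc \<sigma> i))"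
    and A0: "finite A0" "matched A0 \<subseteq> {..<k} - P0"
    and c0: "(\<Sum>(i, j, \<tau>)\<in>A0. dist (loc \<sigma> i) (loc \<sigma> j) + (\<tau> - arr \<sigma> i) + (\<tau> - arr \<sigma> j)) +
      p * real (card ({..<k} - P0 - matched A0)) \<le> (\<Sum>i\<in>{..<k} - P0. charge rate p \<sigma> i)"
    using IH k by auto
  have fP0: "finite P0" using P0 finite_subset by blast
  have rad: "0 \<le> radius rate x" for x using radius_minimum(1)[OF rate] .
  let ?x = "loc \<sigma> k"
  define C where "C = candidates rate p \<sigma> k P0"
  have Csub: "C \<subseteq> P0"
    unfolding C_def candidates_def Let_def by auto
  \<comment> \<open>An arrival of the second class is accepted within the radius of the partner
    alone, so its own charge is not called on for the distance.\<close>
  have Cnear: "dist ?x (loc \<sigma> i) \<le> radius rate (loc \<sigma> i) +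
      (if ?x \<in> points2 rate p then 0 else radius rate ?x)"
    if "i \<in> C" for i
    using that rad[of ?x] unfolding C_def candidates_def Let_def
        by (auto simp: dist_commute split: if_splits)
  \<comment> \<open>Were \<open>?x\<close> also in the ball of another pending \<open>j\<close>, the
    triangle inequality through \<open>?x\<close> would contradict \<open>far\<close>. So the
    candidate set is a singleton in either class, and the tie rule has no choice.\<close>
  have hit: "C = {i}" if "i \<in> P0" "?x \<in> cball (loc \<sigma> i) (radius rate (loc \<sigma> i))" for i
  proof -
    have uniq: "j = i" if "j \<in> P0" "dist ?x (loc \<sigma> j) \<le> radius rate (loc \<sigma> j)" for j
    proof (rule ccontr)
      assume "j \<noteq> i"
      from far[OF \<open>j \<in> P0\<close> \<open>i \<in> P0\<close> this] show False
        using that \<open>?x \<in> cball _ _\<close> dist_triangle[of "loc \<sigma> j" "loc \<sigma> i" ?x]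
        by (simp add: dist_commute)
    qed
    have "dist ?x (loc \<sigma> i) \<le> radius rate (loc \<sigma> i)" using that by (simp add: dist_commute)
    then have eq: "{i \<in> P0. dist ?x (loc \<sigma> i) \<le> radius rate (loc \<sigma> i)} = {i}"
      using uniq that by blast
    have eq2: "{i \<in> P0. loc \<sigma> i \<in> points1 rate p \<and> ?x \<in> cball (loc \<sigma> i) (radius rate (loc \<sigma> i))} =
        {i}"
      using eq P0(2) by (auto simp: dist_commute)
    show ?thesis unfolding C_def candidates_def Let_def eq eq2 by simp
  qed
  consider (match) "C \<noteq> {}" | (clear) "C = {}" "?x \<in> points2 rate p"
    | (pend) "C = {}" "?x \<notin> points2 rate p" by blast
  then show ?case
  proof cases
    case match
    define i where "i = tie (take (Suc k) \<sigma>) C"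
    have "i \<in> C" using tie match finite_subset[OF Csub fP0] by (auto simp: tie_rule_def i_def)
    then have i: "i \<in> P0" using Csub by blast
    have ik: "i < k" "i \<noteq> k" using i P0 by auto
    have PA: "P = P0 - {i}" "A = insert (i, k, arr \<sigma> k) A0"
      using Suc.prems(2) match by (simp_all add: st0 C_def[symmetric] i_def Let_def)
    have new: "(i, k, arr \<sigma> k) \<notin> A0" using A0(2) i by (auto simp: matched_def)
    have mA: "matched A = insert i (insert k (matched A0))" by (auto simp: PA matched_def)
    have S: "{..<Suc k} - P = insert i (insert k ({..<k} - P0))" using i ik P0 by (auto simp: PA)
    have U: "{..<Suc k} - P - matched A = {..<k} - P0 - matched A0"
      unfolding S mA using i ik by auto
    have "arr \<sigma> k - arr \<sigma> i \<le> wait rate \<sigma> i"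
      using free[OF i] ik k by (intro delay_le_wait[OF \<sigma>]) auto
    moreover have "loc \<sigma> i \<notin> points2 rate p" using P0(2)[OF i]
        by (auto simp: points1_def points2_def)
    \<comment> \<open>The arriving request has no delay. The partner \<open>i\<close> pays its own
      radius and delay; \<open>k\<close> adds its radius if it is in the first class, and otherwise
      only a nonnegative surplus \<open>p\<close>.\<close>
    ultimately have "dist (loc \<sigma> i) ?x + (arr \<sigma> k - arr \<sigma> i) \<le> charge rate p \<sigma> i +
        charge rate p \<sigma> k"
      using Cnear[OF \<open>i \<in> C\<close>] p wait_nonneg[OF \<sigma>, of rate k]
      by (auto simp: charge_def dist_commute split: if_splits)
    then have cost: "(\<Sum>(i, j, \<tau>)\<in>A. dist (loc \<sigma> i) (loc \<sigma> j) + (\<tau> - arr \<sigma> i) + (\<tau> - arr \<sigma> j)) +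
      p * real (card ({..<Suc k} - P - matched A)) \<le> (\<Sum>i\<in>{..<Suc k} - P. charge rate p \<sigma> i)"
      unfolding U using c0 A0(1) new i ik by (simp add: PA(2) S)
    \<comment> \<open>A request that is still pending cannot have been hit by \<open>k\<close>: by
      \<open>hit\<close> it would have been the only candidate, hence the one removed.\<close>
    have "loc \<sigma> j' \<notin> cball (loc \<sigma> i') (radius rate (loc \<sigma> i'))"
      if "i' \<in> P" "i' < j'" "j' < Suc k" for i' j'
    proof (cases "j' = k")
      case True
      show ?thesis
      proof
        assume "loc \<sigma> j' \<in> cball (loc \<sigma> i') (radius rate (loc \<sigma> i'))"
        then have "C = {i'}" using hit True that PA by auto
        then show False using \<open>i \<in> C\<close> that PA by auto
      qed
    qed (use that free PA in auto)
    moreover have "finite A" using A0 by (simp add: PA)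
    moreover have "matched A \<subseteq> {..<Suc k} - P" using A0(2) unfolding S mA by auto
    moreover have "P \<subseteq> {..<Suc k}" using P0 PA by auto
    ultimately show ?thesis using P0 far cost by (auto simp: PA(1))
  next
    case clear
    have PA: "P = P0" "A = A0"
      using Suc.prems(2) clear by (simp_all add: st0 C_def[symmetric] Let_def)
    have S: "{..<Suc k} - P0 = insert k ({..<k} - P0)" using P0 by auto
    have kA: "k \<notin> matched A0" using A0 by auto
    have U: "{..<Suc k} - P0 - matched A0 = insert k ({..<k} - P0 - matched A0)"
      unfolding S using kA by auto
    have "(\<Sum>(i, j, \<tau>)\<in>A0. dist (loc \<sigma> i) (loc \<sigma> j) + (\<tau> - arr \<sigma> i) + (\<tau> - arr \<sigma> j)) +
      p * real (card ({..<Suc k} - P0 - matched A0)) \<le> (\<Sum>i\<in>{..<Suc k} - P0. charge rate p \<sigma> i)"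
      unfolding U using c0 clear by (simp add: S charge_def algebra_simps)
    moreover have "loc \<sigma> j' \<notin> cball (loc \<sigma> i') (radius rate (loc \<sigma> i'))"
      if "i' \<in> P0" "i' < j'" "j' < Suc k" for i' j'
      using that hit[of i'] clear free[of i' j'] by (cases "j' = k") auto
    moreover have "P0 \<subseteq> {..<Suc k}" "matched A0 \<subseteq> {..<Suc k} - P0" using P0 A0 by auto
    ultimately show ?thesis using P0 far A0 by (auto simp: PA)
  next
    case pend
    have PA: "P = insert k P0" "A = A0"
      using Suc.prems(2) pend by (simp_all add: st0 C_def[symmetric] Let_def)
    have S: "{..<Suc k} - P = {..<k} - P0" using P0 by (auto simp: PA)
    \<comment> \<open>In the first class the candidate set is empty only if the second, wider test
      of the Radius rule fails for every pending request.\<close>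
    have "\<forall>i\<in>P0. radius rate (loc \<sigma> i) + radius rate ?x < dist ?x (loc \<sigma> i)"
      using pend unfolding C_def candidates_def Let_def by (auto split: if_splits)
    then have far': "\<forall>i\<in>P. \<forall>j\<in>P. i \<noteq> j \<longrightarrow>
       radius rate (loc \<sigma> i) + radius rate (loc \<sigma> j) < dist (loc \<sigma> i) (loc \<sigma> j)"
      using far by (auto simp: PA dist_commute add.commute)
    have "loc \<sigma> j' \<notin> cball (loc \<sigma> i') (radius rate (loc \<sigma> i'))"
      if "i' \<in> P" "i' < j'" "j' < Suc k" for i' j'
      using that hit[of i'] pend free[of i' j'] PA by (cases "j' = k") auto
    moreover have "?x \<in> points1 rate p" using pend by (auto simp: points1_def points2_def)
    ultimately show ?thesis using P0 far' A0 c0 unfolding S by (auto simp: PA)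
  qed
qed

text \<open>The balls around the requests pending at the end are disjoint, so their locations are
  distinct and there are at most \<open>CARD('a)\<close> of them. Their final connections cost at
  most the diameter each, their delays are covered by \<open>wait\<close>, and at most one of them
  is cleared. The excess is therefore independent of the length of the sequence.\<close>

lemma alg_upper:
  fixes \<sigma> :: "'a::{finite, metric_space} request list"
  assumes rate: "\<And>x. 0 < rate x" and p: "0 < p" and tie: "tie_rule tie" and fin: "final_rule fin"
    and \<sigma>: "chronological \<sigma>"
  shows "alg rate p tie fin \<sigma> \<le> (\<Sum>i<length \<sigma>. charge rate p \<sigma> i) +
    (p + real CARD('a) * diameter (UNIV :: 'a set))"
proof -
  define m where "m = length \<sigma>"
  obtain P A where st: "alg_state rate p tie \<sigma> m = (P, A)" by force
  have P: "P \<subseteq> {..<m}" "\<And>i. i \<in> P \<Longrightarrow> loc \<sigma> i \<in> points1 rate p"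
    and far: "\<And>i j. i \<in> P \<Longrightarrow> j \<in> P \<Longrightarrow> i \<noteq> j \<Longrightarrow>
       radius rate (loc \<sigma> i) + radius rate (loc \<sigma> j) < dist (loc \<sigma> i) (loc \<sigma> j)"
    and free: "\<And>i j. i \<in> P \<Longrightarrow> i < j \<Longrightarrow> j < m \<Longrightarrow>
       loc \<sigma> j \<notin> cball (loc \<sigma> i) (radius rate (loc \<sigma> i))"
    and A: "finite A" "matched A \<subseteq> {..<m} - P"
    and cA: "(\<Sum>(i, j, \<tau>)\<in>A. dist (loc \<sigma> i) (loc \<sigma> j) + (\<tau> - arr \<sigma> i) + (\<tau> - arr \<sigma> j)) +
      p * real (card ({..<m} - P - matched A)) \<le> (\<Sum>i\<in>{..<m} - P. charge rate p \<sigma> i)"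
    using alg_state_invariant[OF rate p tie \<sigma> _ st] by (auto simp: m_def)
  have fP: "finite P" using P finite_subset by blast
  have rad: "0 \<le> radius rate x" for x using radius_minimum(1)[OF rate] .
  define D where "D = diameter (UNIV :: 'a set)"
  have D: "dist x y \<le> D" for x y :: 'a
    unfolding D_def by (rule diameter_bounded_bound) (auto intro: finite_imp_bounded)
  have D0: "0 \<le> D" using D[of undefined undefined] by simp
  have "inj_on (loc \<sigma>) P"
  proof (rule inj_onI, rule ccontr)
    fix i j assume ij: "i \<in> P" "j \<in> P" "loc \<sigma> i = loc \<sigma> j" "i \<noteq> j"
    then show False using far[of i j] rad[of "loc \<sigma> i"] rad[of "loc \<sigma> j"] by simp
  qed
  then have cardP: "card P \<le> CARD('a)" by (rule card_inj_on_le) auto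
  define t where "t = arr \<sigma> (m - 1)"
  define g where "g = (\<lambda>(i, j). (i :: nat, j :: nat, t))"
  define F where "F = fin \<sigma> P"
  define B where "B = g ` F"
  have F: "\<And>i j. (i, j) \<in> F \<Longrightarrow> i \<in> P \<and> j \<in> P \<and> i \<noteq> j"
    and Fd: "pairwise (\<lambda>(i, j) (i', j'). {i, j} \<inter> {i', j'} = {}) F"
    and Fc: "card (P - (\<Union>(i, j)\<in>F. {i, j})) = card P mod 2"
    using fin fP unfolding final_rule_def F_def by blast+
  have "F \<subseteq> P \<times> P" using F by auto
  then have fF: "finite F" using fP by (meson finite_SigmaI finite_subset)
  have fB: "finite B" using fF by (simp add: B_def)
  have mB: "matched B = (\<Union>(i, j)\<in>F. {i, j})" by (auto simp: matched_def B_def g_def)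
  have mBP: "matched B \<subseteq> P" using F by (auto simp: mB)
  have Bd: "pairwise (\<lambda>(i, j, \<tau>) (i', j', \<tau>'). {i, j} \<inter> {i', j'} = {}) B"
    unfolding B_def g_def pairwise_image using Fd by (fastforce simp: pairwise_def)
  have Bne: "\<forall>(i, j, \<tau>)\<in>B. i \<noteq> j" using F by (auto simp: B_def g_def)
  have cardB: "card B \<le> card P"
  proof -
    \<comment> \<open>Weight 1 per request makes \<open>sum_matched\<close> count every pair
      twice.\<close>
    have "real (card B) * 2 = real (card (matched B))"
      using sum_matched[OF fB Bne Bd, of "\<lambda>_. 1"] by (simp add: case_prod_beta)
    moreover have "card (matched B) \<le> card P" using mBP fP by (rule card_mono[rotated])
    ultimately show ?thesis by linarith
  qed
  \<comment> \<open>The final matches happen at the arrival of request \<open>m - 1\<close>, where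
    \<open>wait\<close> is cut off. The existence of \<open>i\<close> in \<open>P\<close> guarantees
    that \<open>m\<close> is positive.\<close>
  have wt: "t - arr \<sigma> i \<le> charge rate p \<sigma> i" if i: "i \<in> P" for i
  proof -
    have "t - arr \<sigma> i \<le> wait rate \<sigma> i"
      unfolding t_def using i P(1) free[OF i] by (intro delay_le_wait[OF \<sigma>]) (auto simp: m_def)
    then show ?thesis using P(2)[OF i] rad[of "loc \<sigma> i"]
        by (auto simp: charge_def points1_def points2_def)
  qed
  have ch: "0 \<le> charge rate p \<sigma> i" for i
    using p rad wait_nonneg[OF \<sigma>] by (simp add: charge_def)
  let ?c = "\<lambda>(i, j, \<tau>). dist (loc \<sigma> i) (loc \<sigma> j) + (\<tau> - arr \<sigma> i) + (\<tau> - arr \<sigma> j)"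
  have "A \<inter> B = {}" using A(2) mBP by (fastforce simp: matched_def)
  then have "sum ?c (A \<union> B) = sum ?c A + sum ?c B"
    using A fB by (intro sum.union_disjoint) auto
  moreover have "sum ?c B \<le> (\<Sum>(i, j, \<tau>)\<in>B. D + (charge rate p \<sigma> i + charge rate p \<sigma> j))"
  proof (rule sum_mono, clarify)
    fix i j \<tau> assume "(i, j, \<tau>) \<in> B"
    then have "i \<in> P" "j \<in> P" "\<tau> = t" using F by (auto simp: B_def g_def)
    then show "dist (loc \<sigma> i) (loc \<sigma> j) + (\<tau> - arr \<sigma> i) + (\<tau> - arr \<sigma> j)
      \<le> D + (charge rate p \<sigma> i + charge rate p \<sigma> j)"
      using wt[of i] wt[of j] D[of "loc \<sigma> i" "loc \<sigma> j"] by simp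
  qed
  moreover have "\<dots> = real (card B) * D + (\<Sum>i\<in>matched B. charge rate p \<sigma> i)"
    using sum_matched[OF fB Bne Bd, of "charge rate p \<sigma>"]
    by (simp add: case_prod_beta sum.distrib)
  moreover have "real (card B) * D \<le> real CARD('a) * D"
    using cardB cardP D0 by (intro mult_right_mono) auto
  moreover have "(\<Sum>i\<in>matched B. charge rate p \<sigma> i) \<le> (\<Sum>i\<in>P. charge rate p \<sigma> i)"
    using fP mBP ch by (intro sum_mono2) auto
  moreover have "p * real (card ({..<m} - matched (A \<union> B))) \<le> p *
      real (card ({..<m} - P - matched A)) + p"
  proof -
    \<comment> \<open>The only requests newly cleared are those left out by the final rule, at most
      one by parity.\<close>
    have "{..<m} - matched (A \<union> B) \<subseteq> ({..<m} - P - matched A) \<union> (P - matched B)"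
      by (auto simp: matched_def)
    then have "card ({..<m} - matched (A \<union> B)) \<le> card (({..<m} - P - matched A) \<union> (P - matched B))"
      using fP by (intro card_mono) auto
    also have "\<dots> \<le> card ({..<m} - P - matched A) + card (P - matched B)" by (rule card_Un_le)
    also have "card (P - matched B) \<le> 1" unfolding mB Fc by simp
    finally have "real (card ({..<m} - matched (A \<union> B))) \<le> real (card ({..<m} - P - matched A)) + 1"
      by simp
    from mult_left_mono[OF this, of p] p show ?thesis by (simp add: algebra_simps)
  qed
  moreover have "(\<Sum>i<m. charge rate p \<sigma> i) = (\<Sum>i\<in>{..<m} - P. charge rate p \<sigma> i) +
      (\<Sum>i\<in>P. charge rate p \<sigma> i)"
    using P(1) by (intro sum.subset_diff) auto
  moreover have "alg_solution rate p tie fin \<sigma> = A \<union> B"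
    unfolding alg_solution_def m_def[symmetric] st B_def F_def g_def t_def by simp
  ultimately show ?thesis
    using cA unfolding alg_def cost_def m_def[symmetric] D_def[symmetric] by simp
qed

section \<open>Resampling single coordinates of the arrival process\<close>

locale poisson_arrivals =
  fixes rate :: "'a::{finite, metric_space} \<Rightarrow> real"
  assumes rate_pos: "\<And>x. 0 < rate x"
begin

definition gap_measure :: "real measure" where
  "gap_measure = density lborel (\<lambda>w. ennreal (exponential_density (total_rate rate) w))"

definition step_measure :: "('a \<times> real) measure" where
  "step_measure = measure_pmf (location_pmf rate) \<Otimes>\<^sub>M gap_measure"

abbreviation arrivals :: "nat \<Rightarrow> (nat \<Rightarrow> 'a \<times> real) measure" where
  "arrivals m \<equiv> Pi\<^sub>M {..<m} (\<lambda>_. step_measure)"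

lemma poisson_measure_eq: "poisson_measure rate m = arrivals m"
  by (simp add: poisson_measure_def step_measure_def gap_measure_def)

lemma total_rate_pos: "0 < total_rate rate"
  unfolding total_rate_def using rate_pos by (intro sum_pos) auto

lemma sets_gap_measure [measurable_cong, simp]: "sets gap_measure = sets borel"
  by (simp add: gap_measure_def)

lemma space_gap_measure [simp]: "space gap_measure = UNIV"
  by (simp add: gap_measure_def)

lemma sets_step_measure [measurable_cong]: "sets step_measure = sets (count_space UNIV \<Otimes>\<^sub>M borel)"
  unfolding step_measure_def by (intro sets_pair_measure_cong) auto

lemma space_step_measure [simp]: "space step_measure = UNIV"
  by (simp add: step_measure_def space_pair_measure)

sublocale gap: prob_space gap_measure
  unfolding gap_measure_def by (rule prob_space_exponential_density[OF total_rate_pos])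

sublocale step: pair_prob_space "measure_pmf (location_pmf rate)" gap_measure ..

sublocale step_prob: prob_space step_measure
  unfolding step_measure_def by (rule step.prob_space_axioms)

sublocale prod: product_prob_space "\<lambda>_::nat. step_measure" UNIV ..

lemma nn_integral_gap:
  assumes [measurable]: "f \<in> borel_measurable borel"
  shows "(\<integral>\<^sup>+w. f w \<partial>gap_measure) =
    (\<integral>\<^sup>+w. ennreal (total_rate rate * exp (- w * total_rate rate)) * f w * indicator {0..} w
        \<partial>lborel)"
  unfolding gap_measure_def
  by (subst nn_integral_density)
     (auto simp: exponential_density_def intro!: nn_integral_cong split: split_indicator)

lemma nn_integral_location:
  fixes f :: "'a \<Rightarrow> ennreal"
  shows "(\<integral>\<^sup>+x. f x \<partial>measure_pmf (location_pmf rate)) = (\<Sum>x\<in>UNIV. f x *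
      ennreal (rate x / total_rate rate))"
proof -
  have "set_pmf (location_pmf rate) = UNIV"
    using rate_pos total_rate_pos by (auto simp: set_pmf_iff pmf_location_pmf less_le)
  then show ?thesis
    by (simp add: nn_integral_measure_pmf_finite pmf_location_pmf[OF rate_pos])
qed

text \<open>The inner variable is the one to be resampled: the first order of integration serves
  \<open>resample_gap\<close>, the second \<open>resample_location\<close>.\<close>

lemma nn_integral_step:
  assumes [measurable]: "f \<in> borel_measurable step_measure"
  shows "(\<integral>\<^sup>+y. f y \<partial>step_measure) = (\<integral>\<^sup>+x. \<integral>\<^sup>+w. f (x, w) \<partial>gap_measure
      \<partial>measure_pmf (location_pmf rate))"
    and "(\<integral>\<^sup>+y. f y \<partial>step_measure) = (\<integral>\<^sup>+w. \<integral>\<^sup>+x. f (x, w) \<partial>measure_pmf (location_pmf rate)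
        \<partial>gap_measure)"
proof -
  have [measurable]: "f \<in> borel_measurable (measure_pmf (location_pmf rate) \<Otimes>\<^sub>M gap_measure)"
    using assms by (simp add: step_measure_def)
  show "(\<integral>\<^sup>+y. f y \<partial>step_measure) = (\<integral>\<^sup>+x. \<integral>\<^sup>+w. f (x, w) \<partial>gap_measure
      \<partial>measure_pmf (location_pmf rate))"
    unfolding step_measure_def by (rule gap.nn_integral_fst[symmetric]) measurable
  show "(\<integral>\<^sup>+y. f y \<partial>step_measure) = (\<integral>\<^sup>+w. \<integral>\<^sup>+x. f (x, w) \<partial>measure_pmf (location_pmf rate)
      \<partial>gap_measure)"
    unfolding step_measure_def by (rule step.nn_integral_snd[symmetric]) measurable
qed

lemma measurable_update:
  assumes "k < m" "X \<in> measurable N (arrivals m)" "Y \<in> measurable N step_measure"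
  shows "(\<lambda>z. (X z)(k := Y z)) \<in> measurable N (arrivals m)"
  using assms by (intro measurable_fun_upd[of _ "{..<m}"]) auto

lemma measurable_coordinate:
  "k < m \<Longrightarrow> (\<lambda>\<eta>. \<eta> k) \<in> measurable (arrivals m) step_measure"
  by (rule measurable_component_singleton) simp

lemma measurable_location [measurable (raw)]:
  "k < m \<Longrightarrow> (\<lambda>\<eta>. fst (\<eta> k)) \<in> measurable (arrivals m) (count_space UNIV)"
  using measurable_coordinate[of k m] by measurable

lemma measurable_gap [measurable (raw)]:
  "k < m \<Longrightarrow> (\<lambda>\<eta>. snd (\<eta> k)) \<in> borel_measurable (arrivals m)"
  using measurable_coordinate[of k m] by measurable

lemma measurable_step:
  assumes [measurable]: "X \<in> measurable N (count_space UNIV)" "Y \<in> borel_measurable N"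
  shows "(\<lambda>z. (X z, Y z)) \<in> measurable N step_measure"
  by measurable

text \<open>Overwriting one coordinate by an independent copy does not change the law. This plays
  the part of conditioning on all other coordinates, with every function kept on the same product
  space.\<close>

lemma resample:
  assumes k: "k < m" and f [measurable]: "f \<in> borel_measurable (arrivals m)"
  shows "(\<integral>\<^sup>+\<eta>. f \<eta> \<partial>arrivals m) = (\<integral>\<^sup>+\<eta>. \<integral>\<^sup>+y. f (\<eta>(k := y)) \<partial>step_measure \<partial>arrivals m)"
proof -
  define J where "J = {..<m} - {k}"
  have J: "finite J" "k \<notin> J" and ins: "{..<m} = insert k J" using k by (auto simp: J_def)
  define g where "g = (\<lambda>\<eta>. \<integral>\<^sup>+y. f (\<eta>(k := y)) \<partial>step_measure)"
  have "(\<lambda>(\<eta>, y). f (\<eta>(k := y))) \<in> borel_measurable (arrivals m \<Otimes>\<^sub>M step_measure)"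
    unfolding split_beta
    by (rule measurable_compose[OF measurable_update[OF k measurable_fst measurable_snd] f])
  then have g: "g \<in> borel_measurable (arrivals m)"
    unfolding g_def by (rule step_prob.borel_measurable_nn_integral)
  \<comment> \<open>\<open>arrivals'\<close> names the family of product measures, so that
    \<open>arrivals' J\<close> is the law of the coordinates other than \<open>k\<close>. Splitting
    off \<open>k\<close> by Fubini reduces both \<open>f\<close> and \<open>g\<close> to the same
    integral over \<open>J\<close>, as \<open>g\<close> ignores coordinate \<open>k\<close>.\<close>
  have "(\<integral>\<^sup>+\<eta>. g \<eta> \<partial>arrivals m) = (\<integral>\<^sup>+\<eta>. \<integral>\<^sup>+y. g (\<eta>(k := y)) \<partial>step_measure \<partial>arrivals' J)"
    if "arrivals' = (\<lambda>J. Pi\<^sub>M J (\<lambda>_. step_measure))" for arrivals'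
    unfolding that ins using g J by (intro prod.product_nn_integral_insert) (auto simp: ins)
  moreover have "(\<integral>\<^sup>+y. g (\<eta>(k := y)) \<partial>step_measure) = g \<eta>" for \<eta>
    by (simp add: g_def step_prob.emeasure_space_1[simplified])
  moreover have "(\<integral>\<^sup>+\<eta>. f \<eta> \<partial>arrivals m) = (\<integral>\<^sup>+\<eta>. g \<eta> \<partial>Pi\<^sub>M J (\<lambda>_. step_measure))"
    unfolding g_def ins using f J by (intro prod.product_nn_integral_insert) (auto simp: ins)
  ultimately show ?thesis unfolding g_def by simp
qed

text \<open>Applying \<open>resample\<close> to \<open>f\<close> and to its average \<open>g\<close>
  over the gap reduces the claim to a single coordinate, where it is Fubini.\<close>

lemma resample_gap:
  assumes k: "k < m" and f [measurable]: "f \<in> borel_measurable (arrivals m)"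
  shows "(\<integral>\<^sup>+\<eta>. f \<eta> \<partial>arrivals m) =
    (\<integral>\<^sup>+\<eta>. \<integral>\<^sup>+w. f (\<eta>(k := (fst (\<eta> k), w))) \<partial>gap_measure \<partial>arrivals m)"
proof -
  define g where "g = (\<lambda>\<eta>. \<integral>\<^sup>+w. f (\<eta>(k := (fst (\<eta> k), w))) \<partial>gap_measure)"
  have [measurable]: "g \<in> borel_measurable (arrivals m)"
    unfolding g_def
    by (intro gap.borel_measurable_nn_integral, unfold split_beta)
       (auto intro!: measurable_compose[OF _ f] measurable_update[OF k] measurable_step
         measurable_compose[OF measurable_fst measurable_location[OF k]])
  have "(\<integral>\<^sup>+y. f (\<eta>(k := y)) \<partial>step_measure) = (\<integral>\<^sup>+y. g (\<eta>(k := y)) \<partial>step_measure)"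
    if "\<eta> \<in> space (arrivals m)" for \<eta>
  proof -
    have [measurable]: "(\<lambda>y. f (\<eta>(k := y))) \<in> borel_measurable step_measure"
      "(\<lambda>y. g (\<eta>(k := y))) \<in> borel_measurable step_measure"
      by (auto intro!: measurable_compose[OF _ f] measurable_compose[OF _ \<open>g \<in> _\<close>]
          measurable_update[OF k] measurable_const[OF that])
    show ?thesis
      by (simp add: nn_integral_step(1) g_def gap.emeasure_space_1[simplified])
  qed
  then have "(\<integral>\<^sup>+\<eta>. f \<eta> \<partial>arrivals m) = (\<integral>\<^sup>+\<eta>. g \<eta> \<partial>arrivals m)"
    unfolding resample[OF k f] resample[OF k \<open>g \<in> _\<close>] by (rule nn_integral_cong)
  then show ?thesis by (simp add: g_def)
qed

lemma resample_location:
  assumes k: "k < m" and f [measurable]: "f \<in> borel_measurable (arrivals m)"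
  shows "(\<integral>\<^sup>+\<eta>. f \<eta> \<partial>arrivals m) =
    (\<integral>\<^sup>+\<eta>. \<integral>\<^sup>+x. f (\<eta>(k := (x, snd (\<eta> k)))) \<partial>measure_pmf (location_pmf rate) \<partial>arrivals m)"
proof -
  define g where "g = (\<lambda>\<eta>. \<integral>\<^sup>+x. f (\<eta>(k := (x, snd (\<eta> k)))) \<partial>measure_pmf (location_pmf rate))"
  have [measurable]: "(\<lambda>\<eta>. f (\<eta>(k := (x, snd (\<eta> k))))) \<in> borel_measurable (arrivals m)" for x
    by (auto intro!: measurable_compose[OF _ f] measurable_update[OF k] measurable_step
         measurable_gap[OF k])
  have [measurable]: "g \<in> borel_measurable (arrivals m)"
    unfolding g_def nn_integral_location by measurable
  have "(\<integral>\<^sup>+y. f (\<eta>(k := y)) \<partial>step_measure) = (\<integral>\<^sup>+y. g (\<eta>(k := y)) \<partial>step_measure)"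
    if "\<eta> \<in> space (arrivals m)" for \<eta>
  proof -
    have [measurable]: "(\<lambda>y. f (\<eta>(k := y))) \<in> borel_measurable step_measure"
      "(\<lambda>y. g (\<eta>(k := y))) \<in> borel_measurable step_measure"
      by (auto intro!: measurable_compose[OF _ f] measurable_compose[OF _ \<open>g \<in> _\<close>]
          measurable_update[OF k] measurable_const[OF that])
    show ?thesis
      by (simp add: nn_integral_step(2) g_def measure_pmf.emeasure_space_1[simplified])
  qed
  then have "(\<integral>\<^sup>+\<eta>. f \<eta> \<partial>arrivals m) = (\<integral>\<^sup>+\<eta>. g \<eta> \<partial>arrivals m)"
    unfolding resample[OF k f] resample[OF k \<open>g \<in> _\<close>] by (rule nn_integral_cong)
  then show ?thesis by (simp add: g_def)
qed

section \<open>Survival probabilities\<close>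

text \<open>The probability that a Poisson process of rate \<open>sum rate B\<close> has no arrival
  during a time \<open>v\<close>; once the time left is negative, survival is certain.\<close>

definition survival :: "'a set \<Rightarrow> real \<Rightarrow> real" where
  "survival B v = exp (- (sum rate B * max v 0))"

text \<open>The value of the survival function between the waiting time and the location of an arrival.\<close>

definition survival_mid :: "'a set \<Rightarrow> real \<Rightarrow> real" where
  "survival_mid B v = (if v < 0 then 1 else (1 - sum rate B / total_rate rate) *
      exp (- (sum rate B * v)))"

lemma sum_rate_le: "sum rate B \<le> total_rate rate"
  unfolding total_rate_def using rate_pos by (intro sum_mono2) (auto simp: less_imp_le)

lemma sum_rate_nonneg: "0 \<le> sum rate B"
  using rate_pos by (intro sum_nonneg) (auto simp: less_imp_le)

lemma survival_measurable [measurable]: "survival B \<in> borel_measurable borel"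
  unfolding survival_def by measurable

lemma survival_mid_measurable [measurable]: "survival_mid B \<in> borel_measurable borel"
  unfolding survival_mid_def by measurable

lemma survival_le_1: "survival B v \<le> 1"
  using sum_rate_nonneg[of B] by (simp add: survival_def)

text \<open>First half of the martingale step, conditioning on the next gap \<open>w\<close>. If
  \<open>w > v\<close>, the time window ends before the arrival; otherwise the arrival must miss
  \<open>B\<close>, and a window of length \<open>v - w\<close> remains.\<close>

lemma nn_integral_gap_survival:
  "(\<integral>\<^sup>+w. ennreal (survival_mid B (v - w)) \<partial>gap_measure) = ennreal (survival B v)"
proof (cases "v < 0")
  case True
  have "(\<integral>\<^sup>+w. ennreal (survival_mid B (v - w)) \<partial>gap_measure) = (\<integral>\<^sup>+w. 1 \<partial>gap_measure)"
    using True by (simp add: nn_integral_gap del: nn_integral_const)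
      (auto intro!: nn_integral_cong simp: survival_mid_def split: split_indicator)
  then show ?thesis using True by (simp add: survival_def gap.emeasure_space_1[simplified])
next
  case False
  define L a where "L = total_rate rate" and "a = sum rate B"
  have L: "0 < L" "a \<le> L" "0 \<le> a"
    using total_rate_pos sum_rate_le sum_rate_nonneg by (auto simp: L_def a_def)
  have v: "0 \<le> v" using False by simp
  let ?f = "\<lambda>w. (L - a) * exp (- (a * v)) * exp (- ((L - a) * w))"
  let ?h = "\<lambda>w. L * exp (- (L * w))"
  have "(\<integral>\<^sup>+w. ennreal (survival_mid B (v - w)) \<partial>gap_measure) =
      (\<integral>\<^sup>+w. ennreal (?f w) * indicator {0..v} w + ennreal (?h w) * indicator {v..} w \<partial>lborel)"
  proof (subst nn_integral_gap)
    \<comment> \<open>Both indicators on the right contain \<open>v\<close>, a null set.\<close>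
    have "AE w in lborel. w \<noteq> v" by (rule AE_lborel_singleton)
    then show "(\<integral>\<^sup>+w. ennreal (total_rate rate * exp (- w * total_rate rate)) *
        ennreal (survival_mid B (v - w)) * indicator {0..} w \<partial>lborel) =
      (\<integral>\<^sup>+w. ennreal (?f w) * indicator {0..v} w + ennreal (?h w) * indicator {v..} w \<partial>lborel)"
    proof (intro nn_integral_cong_AE, eventually_elim)
      fix w assume "w \<noteq> v"
      consider "w < 0" | "0 \<le> w" "w < v" | "v < w" using \<open>w \<noteq> v\<close> by linarith
      then show "ennreal (total_rate rate * exp (- w * total_rate rate)) *
        ennreal (survival_mid B (v - w)) * indicator {0..} w =
        ennreal (?f w) * indicator {0..v} w + ennreal (?h w) * indicator {v..} w"
      proof cases
        case 2
        have "L * exp (- w * L) * ((1 - a / L) * exp (- (a * (v - w)))) = ?f w"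
        proof -
          have "L * (1 - a / L) = L - a" using L by (simp add: field_simps)
          moreover have "exp (- w * L) * exp (- (a * (v - w))) = exp (- (a * v)) *
              exp (- ((L - a) * w))"
            by (simp add: exp_add[symmetric] algebra_simps)
          ultimately show ?thesis by (metis mult.assoc mult.left_commute)
        qed
        then show ?thesis
          using 2 L by (simp add: survival_mid_def L_def[symmetric] a_def[symmetric]
              ennreal_mult[symmetric] field_simps)
      qed (use v in \<open>auto simp: survival_mid_def L_def mult.commute\<close>)
    qed
  qed measurable
  also have "\<dots> = (\<integral>\<^sup>+w. ennreal (?f w) * indicator {0..v} w \<partial>lborel) +
      (\<integral>\<^sup>+w. ennreal (?h w) * indicator {v..} w \<partial>lborel)"
    by (rule nn_integral_add) measurable
  \<comment> \<open>The antiderivative involves no division by \<open>L - a\<close>, which vanishes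
    when \<open>B\<close> is the whole space.\<close>
  also have "(\<integral>\<^sup>+w. ennreal (?f w) * indicator {0..v} w \<partial>lborel) =
      ennreal (- exp (- (a * v)) * exp (- ((L - a) * v)) - (- exp (- (a * v)) * exp (- ((L - a) *
          0))))"
  proof (intro nn_integral_FTC_Icc)
    fix w
    show "((\<lambda>w. - exp (- (a * v)) * exp (- ((L - a) * w))) has_real_derivative ?f w) (at w)"
      by (auto intro!: derivative_eq_intros simp: algebra_simps)
    show "0 \<le> ?f w" using L by simp
  qed (use v in auto)
  also have "(\<integral>\<^sup>+w. ennreal (?h w) * indicator {v..} w \<partial>lborel) = ennreal (0 - (- exp (- (L * v))))"
  proof (rule nn_integral_FTC_atLeast)
    have "((\<lambda>w. - exp (- (L * w))) \<longlongrightarrow> - 0) at_top"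
      using L by (intro tendsto_minus filterlim_compose[OF exp_at_bot]
        filterlim_compose[OF filterlim_uminus_at_bot_at_top] filterlim_tendsto_pos_mult_at_top[OF
            tendsto_const] filterlim_ident) auto
    then show "((\<lambda>w. - exp (- (L * w))) \<longlongrightarrow> 0) at_top" by simp
  qed (use L in \<open>auto intro!: derivative_eq_intros\<close>)
  also have "- exp (- (a * v)) * exp (- ((L - a) * v)) = - exp (- (L * v))"
    by (simp add: exp_add[symmetric] algebra_simps)
  also have "ennreal (- exp (- (L * v)) - (- exp (- (a * v)) * exp (- ((L - a) * 0)))) +
      ennreal (0 - (- exp (- (L * v)))) = ennreal (exp (- (a * v)))"
    using L v by (subst ennreal_plus[symmetric]) (auto intro: mult_right_mono)
  finally show ?thesis using v by (simp add: survival_def a_def max_def)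
qed

lemma location_avoid_prob:
  "(\<integral>\<^sup>+x. (if x \<in> B then 0 else 1) \<partial>measure_pmf (location_pmf rate)) =
    ennreal (1 - sum rate B / total_rate rate)"
proof -
  have "(\<integral>\<^sup>+x. (if x \<in> B then 0 else 1) \<partial>measure_pmf (location_pmf rate)) =
      (\<Sum>x\<in>UNIV - B. ennreal (rate x / total_rate rate))"
    unfolding nn_integral_location by (intro sum.mono_neutral_cong_right) auto
  also have "\<dots> = ennreal (sum rate (UNIV - B) / total_rate rate)"
    using rate_pos total_rate_pos by (subst sum_ennreal) (auto simp: sum_divide_distrib less_imp_le)
  also have "sum rate (UNIV - B) / total_rate rate = 1 - sum rate B / total_rate rate"
    using total_rate_pos by (subst sum_diff) (auto simp: total_rate_def[symmetric]
        diff_divide_distrib)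
  finally show ?thesis .
qed

text \<open>Second half of the martingale step: \<open>s\<close> is the time of the arrival, and
  averaging over its location turns \<open>survival\<close> into \<open>survival_mid\<close>. If the
  arrival falls outside the window, both are 1.\<close>

lemma nn_integral_location_survival:
  "(\<integral>\<^sup>+x. (if x \<in> B \<and> s \<le> u then 0 else 1) * ennreal (survival B (u - s))
      \<partial>measure_pmf (location_pmf rate)) =
    ennreal (survival_mid B (u - s))"
proof (cases "s \<le> u")
  case True
  then show ?thesis
    using sum_rate_le[of B] total_rate_pos
    by (simp add: nn_integral_multc location_avoid_prob survival_mid_def survival_def ennreal_mult)
next
  case False
  then show ?thesis
    by (simp add: survival_mid_def survival_def measure_pmf.emeasure_space_1[simplified])
qed

text \<open>\<open>g\<close> and \<open>l\<close> enumerate the waiting times and the locations met when moving away from a request,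
  so that the statement covers both the future and the past, where they are shifted against each
  other. On surviving paths \<open>survival B (u - S n \<eta>)\<close> is a martingale, hence the equality.\<close>

lemma survival_chain:
  fixes g l :: "nat \<Rightarrow> nat"
  defines "S \<equiv> \<lambda>k \<eta>. \<Sum>j<k. snd (\<eta> (g j) :: 'a \<times> real)"
  assumes bd: "\<And>k. k < n \<Longrightarrow> g k < m \<and> l k < m"
    and inj: "inj_on g {..<n}" "inj_on l {..<n}"
    and \<Psi> [measurable]: "\<Psi> \<in> borel_measurable (arrivals m)"
    and \<Psi>_gap: "\<And>k \<eta> w. k < n \<Longrightarrow> \<Psi> (\<eta>(g k := (fst (\<eta> (g k)), w))) = \<Psi> \<eta>"
    and \<Psi>_loc: "\<And>k \<eta> x. k < n \<Longrightarrow> \<Psi> (\<eta>(l k := (x, snd (\<eta> (l k))))) = \<Psi> \<eta>"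
  shows "(\<integral>\<^sup>+\<eta>. \<Psi> \<eta> * (\<Prod>k<n. if fst (\<eta> (l k)) \<in> B \<and> S (Suc k) \<eta> \<le> u then 0 else 1) *
      ennreal (survival B (u - S n \<eta>)) \<partial>arrivals m) = (\<integral>\<^sup>+\<eta>. \<Psi> \<eta> \<partial>arrivals m) *
          ennreal (survival B u)"
  using bd inj \<Psi>_gap \<Psi>_loc
proof (induction n)
  case 0
  then show ?case by (simp add: S_def nn_integral_multc)
next
  case (Suc n)
  define Q where "Q = (\<lambda>n \<eta>. \<Prod>k<n. if fst (\<eta> (l k)) \<in> B \<and> S (Suc k) \<eta> \<le>
      u then 0 else (1 :: ennreal))"
  have S_meas: "S k \<in> borel_measurable (arrivals m)" if "k \<le> Suc n" for k
    unfolding S_def using Suc.prems(1) that by (intro borel_measurable_sum measurable_gap) auto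
  have Q_meas: "Q k \<in> borel_measurable (arrivals m)" if "k \<le> Suc n" for k
    unfolding Q_def
  proof (intro borel_measurable_prod_ennreal)
    fix j assume "j \<in> {..<k}"
    then have [measurable]: "S (Suc j) \<in> borel_measurable (arrivals m)"
      "(\<lambda>\<eta>. fst (\<eta> (l j))) \<in> measurable (arrivals m) (count_space UNIV)"
      using that Suc.prems(1) by (auto intro: S_meas measurable_location)
    show "(\<lambda>\<eta>. if fst (\<eta> (l j)) \<in> B \<and> S (Suc j) \<eta> \<le>
        u then 0 else (1 :: ennreal)) \<in> borel_measurable (arrivals m)"
      by measurable
  qed
  have [measurable]: "S n \<in> borel_measurable (arrivals m)" "S (Suc n) \<in> borel_measurable (arrivals
      m)"
    "Q n \<in> borel_measurable (arrivals m)" "Q (Suc n) \<in> borel_measurable (arrivals m)"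
    by (auto intro: S_meas Q_meas)
  have ln: "l n < m" and gn: "g n < m" using Suc.prems(1) by auto
  have lneq: "l k \<noteq> l n" if "k < n" for k using Suc.prems(3) that by (auto dest: inj_onD)
  have gneq: "g k \<noteq> g n" if "k < n" for k using Suc.prems(2) that by (auto dest: inj_onD)
  \<comment> \<open>Updating a location leaves all gaps unchanged and conversely. So
    \<open>g\<close> and \<open>l\<close> may share indices; only the injectivity of each of them
    separately matters here.\<close>
  have S_loc: "S k (\<eta>(l n := (x, snd (\<eta> (l n))))) = S k \<eta>" for k \<eta> x
    unfolding S_def by (intro sum.cong) auto
  have Q_loc: "Q n (\<eta>(l n := (x, snd (\<eta> (l n))))) = Q n \<eta>" for \<eta> x
    unfolding Q_def S_loc using lneq by (intro prod.cong) auto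
  have S_gap: "S k (\<eta>(g n := (fst (\<eta> (g n)), w))) = S k \<eta>" if "k \<le> n" for k \<eta> w
    unfolding S_def using gneq that by (intro sum.cong) auto
  have Q_gap: "Q n (\<eta>(g n := (fst (\<eta> (g n)), w))) = Q n \<eta>" for \<eta> w
    unfolding Q_def using S_gap by (intro prod.cong) auto
  have S_Suc: "S (Suc n) (\<eta>(g n := (fst (\<eta> (g n)), w))) = S n \<eta> + w" for \<eta> w
    using S_gap[of n \<eta> w] by (simp add: S_def)
  have Q_Suc: "Q (Suc n) \<eta> = Q n \<eta> * (if fst (\<eta> (l n)) \<in> B \<and> S (Suc n) \<eta> \<le> u then 0 else 1)" for \<eta>
    by (simp add: Q_def)
  \<comment> \<open>The last location is averaged before the last gap: whether it counts depends on
    the time \<open>S (Suc n)\<close>, which contains that gap and must stay fixed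
    meanwhile.\<close>
  have "(\<integral>\<^sup>+\<eta>. \<Psi> \<eta> * Q (Suc n) \<eta> * ennreal (survival B (u - S (Suc n) \<eta>)) \<partial>arrivals m) =
      (\<integral>\<^sup>+\<eta>. \<integral>\<^sup>+x. \<Psi> \<eta> * Q n \<eta> * ((if x \<in> B \<and> S (Suc n) \<eta> \<le> u then 0 else 1) *
        ennreal (survival B (u - S (Suc n) \<eta>))) \<partial>measure_pmf (location_pmf rate) \<partial>arrivals m)"
    by (subst resample_location[OF ln]) (measurable, simp add: Q_Suc Q_loc S_loc Suc.prems(5)
        mult.assoc)
  also have "\<dots> = (\<integral>\<^sup>+\<eta>. \<Psi> \<eta> * Q n \<eta> * ennreal (survival_mid B (u - S (Suc n) \<eta>)) \<partial>arrivals m)"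
    by (simp add: nn_integral_cmult nn_integral_location_survival)
  also have "\<dots> = (\<integral>\<^sup>+\<eta>. \<integral>\<^sup>+w. \<Psi> \<eta> * Q n \<eta> * ennreal (survival_mid B (u - S n \<eta> - w)) \<partial>gap_measure
      \<partial>arrivals m)"
    by (subst resample_gap[OF gn]) (measurable, simp add: Q_gap S_Suc Suc.prems(4) diff_diff_eq)
  also have "\<dots> = (\<integral>\<^sup>+\<eta>. \<Psi> \<eta> * Q n \<eta> * ennreal (survival B (u - S n \<eta>)) \<partial>arrivals m)"
    by (simp add: nn_integral_cmult nn_integral_gap_survival)
  also have "\<dots> = (\<integral>\<^sup>+\<eta>. \<Psi> \<eta> \<partial>arrivals m) * ennreal (survival B u)"
    unfolding Q_def using Suc.prems by (intro Suc.IH) (auto simp: inj_on_def)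
  finally show ?case unfolding Q_def .
qed

text \<open>The survival factor for the time left after \<open>n\<close> arrivals is at most 1 and
  is dropped.\<close>

lemma survival_chain_le:
  fixes g l :: "nat \<Rightarrow> nat"
  assumes "\<And>k. k < n \<Longrightarrow> g k < m \<and> l k < m" "inj_on g {..<n}" "inj_on l {..<n}"
    and "\<Psi> \<in> borel_measurable (arrivals m)"
    and "\<And>k \<eta> w. k < n \<Longrightarrow> \<Psi> (\<eta>(g k := (fst (\<eta> (g k)), w))) = \<Psi> \<eta>"
    and "\<And>k \<eta> x. k < n \<Longrightarrow> \<Psi> (\<eta>(l k := (x, snd (\<eta> (l k))))) = \<Psi> \<eta>"
  shows "(\<integral>\<^sup>+\<eta>. \<Psi> \<eta> \<partial>arrivals m) * ennreal (survival B u) \<le>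
    (\<integral>\<^sup>+\<eta>. \<Psi> \<eta> * (\<Prod>k<n. if fst (\<eta> (l k)) \<in> B \<and> (\<Sum>j<Suc k. snd (\<eta> (g j))) \<le> u then 0 else 1)
        \<partial>arrivals m)"
proof -
  let ?P = "\<lambda>\<eta>. \<Psi> \<eta> * (\<Prod>k<n. if fst (\<eta> (l k)) \<in> B \<and> (\<Sum>j<Suc k. snd (\<eta> (g j))) \<le> u then 0 else 1)"
  have "(\<integral>\<^sup>+\<eta>. \<Psi> \<eta> \<partial>arrivals m) * ennreal (survival B u) =
      (\<integral>\<^sup>+\<eta>. ?P \<eta> * ennreal (survival B (u - (\<Sum>j<n. snd (\<eta> (g j))))) \<partial>arrivals m)"
    by (rule survival_chain[OF assms, symmetric])
  also have "\<dots> \<le> (\<integral>\<^sup>+\<eta>. ?P \<eta> * 1 \<partial>arrivals m)"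
    by (intro nn_integral_mono mult_left_mono)
       (use survival_le_1 in \<open>auto simp flip: ennreal_1 intro!: ennreal_leI\<close>)
  finally show ?thesis by simp
qed

end

section \<open>Request sequences in terms of locations and waiting times\<close>

lemma loc_request_seq [simp]: "i < m \<Longrightarrow> loc (request_seq m \<eta>) i = fst (\<eta> i)"
  by (simp add: loc_def request_seq_def)

lemma arr_request_seq [simp]: "i < m \<Longrightarrow> arr (request_seq m \<eta>) i = (\<Sum>j\<le>i. snd (\<eta> j))"
  by (simp add: arr_def request_seq_def)

lemma length_request_seq [simp]: "length (request_seq m \<eta>) = m"
  by (simp add: request_seq_def)

context poisson_arrivals begin

section \<open>Lower bound for the optimum\<close>

text \<open>This is the \<open>r\<^sub>x\<close> of the overview; \<open>mean_radius\<close> is the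
  \<open>s\<close> there.\<close>

definition capped_radius :: "real \<Rightarrow> 'a \<Rightarrow> real" where
  "capped_radius p x = min (radius rate x) p"

definition mean_radius :: "real \<Rightarrow> real" where
  "mean_radius p = (\<Sum>x\<in>UNIV. rate x / total_rate rate * capped_radius p x)"

lemma radius_pos: "0 < radius rate x"
proof -
  have "0 < sum rate (cball x (radius rate x))"
    using rate_pos radius_minimum(1)[of rate x, OF rate_pos] by (intro sum_pos) auto
  then show ?thesis
    using radius_minimum(2)[of rate x, OF rate_pos] by (smt (verit) zero_less_divide_1_iff)
qed

lemma capped_radius_pos: "0 < p \<Longrightarrow> 0 < capped_radius p x"
  by (simp add: capped_radius_def radius_pos)

lemma mean_radius_pos: "0 < p \<Longrightarrow> 0 < mean_radius p"
  unfolding mean_radius_def using rate_pos total_rate_pos capped_radius_pos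
  by (intro sum_pos mult_pos_pos divide_pos_pos) auto

text \<open>In a finite space the open ball is contained in a closed ball of smaller radius. If its
  rate exceeded \<open>1 / r\<close>, such a smaller radius would be admissible in the definition of
  \<open>radius\<close>, against minimality.\<close>

lemma rate_ball_le:
  assumes "0 < r" "r \<le> radius rate x"
  shows "sum rate (ball x r) \<le> 1 / r"
proof (rule ccontr)
  assume neg: "\<not> ?thesis"
  define s where "s = sum rate (ball x r)"
  have s: "1 / r < s" using neg by (simp add: s_def)
  have s0: "0 < s" using s assms(1) by (smt (verit) zero_less_divide_1_iff)
  define D where "D = dist x ` ball x r"
  \<comment> \<open>The first term makes the closed ball contain the open one, the second makes
    \<open>u\<close> admissible; both are less than \<open>r\<close>.\<close>
  define u where "u = max (Max D) (1 / s)"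
  have D: "finite D" "D \<noteq> {}" using assms(1) by (auto simp: D_def)
  have "Max D < r" using D by (subst Max_less_iff) (auto simp: D_def)
  moreover have "1 / s < r" using s s0 assms(1) by (simp add: field_simps)
  ultimately have u: "u < r" by (simp add: u_def)
  have u0: "0 < u" using s0 by (simp add: u_def less_max_iff_disj)
  have "ball x r \<subseteq> cball x u"
  proof
    fix y assume "y \<in> ball x r"
    then have "dist x y \<le> Max D" using D by (intro Max_ge) (auto simp: D_def)
    then show "y \<in> cball x u" by (simp add: u_def)
  qed
  then have "s \<le> sum rate (cball x u)"
    unfolding s_def using rate_pos by (intro sum_mono2) (auto simp: less_imp_le)
  then have "1 / sum rate (cball x u) \<le> 1 / s"
    using s0 by (intro divide_left_mono) auto
  also have "\<dots> \<le> u" by (simp add: u_def)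
  finally have "radius rate x \<le> u" using u0 radius_minimum(3)[where rate = rate and x = x and u =
      u, OF rate_pos] by simp
  then show False using u assms by simp
qed

sublocale arrivals: prob_space "arrivals m" for m
  by (rule prob_space_PiM) (rule step_prob.prob_space_axioms)

lemma nn_integral_mult_location:
  assumes k: "k < m" and [measurable]: "\<Psi> \<in> borel_measurable (arrivals m)"
    and \<Psi>: "\<And>\<eta> x. \<Psi> (\<eta>(k := (x, snd (\<eta> k)))) = \<Psi> \<eta>"
  shows "(\<integral>\<^sup>+\<eta>. \<Psi> \<eta> * f (fst (\<eta> k)) \<partial>arrivals m) =
    (\<integral>\<^sup>+\<eta>. \<Psi> \<eta> \<partial>arrivals m) * (\<integral>\<^sup>+x. f x \<partial>measure_pmf (location_pmf rate))"
proof -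
  have "(\<lambda>\<eta>. f (fst (\<eta> k))) \<in> borel_measurable (arrivals m)"
    by (rule measurable_compose[OF measurable_location[OF k]]) simp
  then show ?thesis
    by (subst resample_location[OF k]) (auto simp: \<Psi> nn_integral_cmult nn_integral_multc)
qed

lemma nn_integral_mult_gap:
  assumes k: "k < m" and [measurable]: "\<Psi> \<in> borel_measurable (arrivals m)" "f \<in> borel_measurable
      borel"
    and \<Psi>: "\<And>\<eta> w. \<Psi> (\<eta>(k := (fst (\<eta> k), w))) = \<Psi> \<eta>"
  shows "(\<integral>\<^sup>+\<eta>. \<Psi> \<eta> * f (snd (\<eta> k)) \<partial>arrivals m) =
    (\<integral>\<^sup>+\<eta>. \<Psi> \<eta> \<partial>arrivals m) * (\<integral>\<^sup>+w. f w \<partial>gap_measure)"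
proof -
  have [measurable]: "(\<lambda>\<eta>. f (snd (\<eta> k))) \<in> borel_measurable (arrivals m)"
    by (rule measurable_compose[OF measurable_gap[OF k]]) simp
  show ?thesis
    by (subst resample_gap[OF k]) (auto simp: \<Psi> nn_integral_cmult nn_integral_multc)
qed

section \<open>The probability that a request is isolated in space and time\<close>

lemma nn_integral_location_eq:
  assumes "i < m"
  shows "(\<integral>\<^sup>+\<eta>. (if fst (\<eta> i) = x then 1 else 0) \<partial>arrivals m) = ennreal (rate x / total_rate rate)"
proof -
  have "(\<integral>\<^sup>+\<eta>. 1 * (if fst (\<eta> i) = x then 1 else 0) \<partial>arrivals m) =
      (\<integral>\<^sup>+\<eta>. 1 \<partial>arrivals m) * (\<integral>\<^sup>+y. (if y = x then 1 else 0) \<partial>measure_pmf (location_pmf rate))"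
    using assms by (intro nn_integral_mult_location) auto
  also have "(\<integral>\<^sup>+y. (if y = x then 1 else 0) \<partial>measure_pmf (location_pmf rate)) =
      (\<Sum>y\<in>{x}. ennreal (rate y / total_rate rate))"
    unfolding nn_integral_location by (rule sum.mono_neutral_cong_right) auto
  finally show ?thesis by (simp add: arrivals.emeasure_space_1)
qed

text \<open>Two chains in succession, each contributing a factor \<open>survival B u\<close>: one
  into the future of request \<open>i\<close>, then one into its past, with the first event as part
  of the weight. Hence the factor 2 in the exponent.\<close>

lemma isolated_prob:
  assumes i: "i < m" and u: "0 \<le> u"
  shows "ennreal (rate x / total_rate rate * exp (- (2 * sum rate B * u))) \<le>
    (\<integral>\<^sup>+\<eta>. (if fst (\<eta> i) = x \<and> (\<forall>j\<in>{..<m} - {i}. fst (\<eta> j) \<in> B \<longrightarrow>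
       u < \<bar>(\<Sum>l\<le>i. snd (\<eta> l)) - (\<Sum>l\<le>j. snd (\<eta> l))\<bar>) then 1 else 0) \<partial>arrivals m)"
    (is "_ \<le> (\<integral>\<^sup>+\<eta>. ?I \<eta> \<partial>_)")
proof -
  define \<Psi>0 where "\<Psi>0 = (\<lambda>\<eta>::nat \<Rightarrow> 'a \<times> real. if fst (\<eta> i) = x then 1 else (0::ennreal))"
  define fw where "fw = (\<lambda>\<eta>::nat \<Rightarrow> 'a \<times> real. \<Prod>k<m - Suc i.
     if fst (\<eta> (Suc i + k)) \<in> B \<and> (\<Sum>j<Suc k. snd (\<eta> (Suc i + j))) \<le> u then 0 else (1::ennreal))"
  \<comment> \<open>Going back in time, the gap of request \<open>i\<close> is crossed before the
    location of request \<open>i - 1\<close> is met; so gaps are indexed by \<open>i - k\<close> and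
    locations by \<open>i - Suc k\<close>.\<close>
  define bw where "bw = (\<lambda>\<eta>::nat \<Rightarrow> 'a \<times> real. \<Prod>k<i.
     if fst (\<eta> (i - Suc k)) \<in> B \<and> (\<Sum>j<Suc k. snd (\<eta> (i - j))) \<le> u then 0 else (1::ennreal))"
  note measurable_location[OF i, measurable]
  have [measurable]: "\<Psi>0 \<in> borel_measurable (arrivals m)" unfolding \<Psi>0_def by measurable
  have [measurable]: "fw \<in> borel_measurable (arrivals m)"
    unfolding fw_def
  proof (rule borel_measurable_prod_ennreal)
    fix k assume k: "k \<in> {..<m - Suc i}"
    have [measurable]: "(\<lambda>\<eta>. \<Sum>j<Suc k. snd (\<eta> (Suc i + j))) \<in> borel_measurable (arrivals m)"
      using k by (intro borel_measurable_sum measurable_gap) auto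
    have [measurable]: "(\<lambda>\<eta>. fst (\<eta> (Suc i + k))) \<in> measurable (arrivals m) (count_space UNIV)"
      using k by (intro measurable_location) auto
    show "(\<lambda>\<eta>. if fst (\<eta> (Suc i + k)) \<in> B \<and> (\<Sum>j<Suc k. snd (\<eta> (Suc i + j))) \<le>
        u then 0 else (1::ennreal))
      \<in> borel_measurable (arrivals m)" by measurable
  qed
  have "(\<integral>\<^sup>+\<eta>. \<Psi>0 \<eta> \<partial>arrivals m) * ennreal (survival B u) \<le> (\<integral>\<^sup>+\<eta>. \<Psi>0 \<eta> * fw \<eta> \<partial>arrivals m)"
    unfolding fw_def by (rule survival_chain_le) (auto simp: \<Psi>0_def inj_on_def)
  then have "(\<integral>\<^sup>+\<eta>. \<Psi>0 \<eta> \<partial>arrivals m) * ennreal (survival B u) * ennreal (survival B u) \<le>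
      (\<integral>\<^sup>+\<eta>. \<Psi>0 \<eta> * fw \<eta> \<partial>arrivals m) * ennreal (survival B u)"
    by (rule mult_right_mono) simp
  also have "\<dots> \<le> (\<integral>\<^sup>+\<eta>. \<Psi>0 \<eta> * fw \<eta> * bw \<eta> \<partial>arrivals m)"
    unfolding bw_def
  proof (rule survival_chain_le)
    \<comment> \<open>The backward chain may change the gap of request \<open>i\<close>, but neither
      its location nor anything after it, so the forward event is unaffected.\<close>
    fix k \<eta> w assume "k < i"
    moreover have "Suc (i + j) \<noteq> i - k" for j by arith
    ultimately show "\<Psi>0 (\<eta>(i - k := (fst (\<eta> (i - k)), w))) * fw (\<eta>(i - k :=
        (fst (\<eta> (i - k)), w))) = \<Psi>0 \<eta> * fw \<eta>"
      unfolding \<Psi>0_def fw_def by (intro arg_cong2[where f = "(*)"] prod.cong) auto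
  next
    fix k \<eta> y assume "k < i"
    moreover have "Suc (i + j) \<noteq> i - Suc k" for j by arith
    ultimately show "\<Psi>0 (\<eta>(i - Suc k := (y, snd (\<eta> (i - Suc k))))) * fw (\<eta>(i - Suc k :=
        (y, snd (\<eta> (i - Suc k))))) = \<Psi>0 \<eta> * fw \<eta>"
      unfolding \<Psi>0_def fw_def by (intro arg_cong2[where f = "(*)"] prod.cong) auto
  qed (use i in \<open>auto simp: inj_on_def\<close>)
  also have "\<dots> \<le> (\<integral>\<^sup>+\<eta>. ?I \<eta> \<partial>arrivals m)"
  proof (rule nn_integral_mono)
    fix \<eta> :: "nat \<Rightarrow> 'a \<times> real"
    define t where "t = (\<lambda>j. \<Sum>l\<le>j. snd (\<eta> l))"
    have fsum: "(\<Sum>j<Suc k. snd (\<eta> (Suc i + j))) = t (Suc i + k) - t i" for k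
      by (induction k) (auto simp: t_def)
    have bsum: "(\<Sum>j<Suc k. snd (\<eta> (i - j))) = t i - t (i - Suc k)" if "k < i" for k
      using that
    proof (induction k)
      case 0
      then show ?case by (cases i) (auto simp: t_def)
    next
      case (Suc k)
      then have "i - Suc k = Suc (i - Suc (Suc k))" by simp
      then have "t (i - Suc k) = t (i - Suc (Suc k)) + snd (\<eta> (i - Suc k))"
        unfolding t_def by (metis sum.atMost_Suc)
      with Suc show ?case by simp
    qed
    have fw1: "fw \<eta> \<le> 1" and bw1: "bw \<eta> \<le> 1"
      unfolding fw_def bw_def by (auto intro!: prod_le_1)
    \<comment> \<open>Path by path: if the product is nonzero, no factor vanishes, which is exactly
      isolation to both sides.\<close>
    show "\<Psi>0 \<eta> * fw \<eta> * bw \<eta> \<le> ?I \<eta>"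
    proof (cases "\<Psi>0 \<eta> * fw \<eta> * bw \<eta> = 0")
      case False
      have "fst (\<eta> i) = x" using False by (auto simp: \<Psi>0_def split: if_splits)
      moreover have "u < \<bar>t i - t j\<bar>" if j: "j \<in> {..<m} - {i}" "fst (\<eta> j) \<in> B" for j
      proof (cases "i < j")
        case True
        then obtain k where k: "j = Suc i + k" by (metis less_imp_Suc_add add_Suc)
        then have "k < m - Suc i" using j by auto
        then have "\<not> (fst (\<eta> (Suc i + k)) \<in> B \<and> (\<Sum>j<Suc k. snd (\<eta> (Suc i + j))) \<le> u)"
          using False unfolding fw_def by (auto simp: prod_zero_iff simp del: sum.lessThan_Suc
              split: if_splits)
        then show ?thesis unfolding fsum using j k by auto
      next
        case False': False
        define k where "k = i - Suc j"
        have k: "k < i" "i - Suc k = j" using False' j by (auto simp: k_def)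
        then have "\<not> (fst (\<eta> (i - Suc k)) \<in> B \<and> (\<Sum>j<Suc k. snd (\<eta> (i - j))) \<le> u)"
          using False unfolding bw_def by (auto simp: prod_zero_iff simp del: sum.lessThan_Suc
              split: if_splits)
        then show ?thesis unfolding bsum[OF k(1)] using j k by auto
      qed
      ultimately have "?I \<eta> = 1" by (simp add: t_def)
      moreover have "\<Psi>0 \<eta> * fw \<eta> * bw \<eta> \<le> 1 * 1 * 1"
        using fw1 bw1 by (intro mult_mono) (auto simp: \<Psi>0_def)
      ultimately show ?thesis by simp
    qed auto
  qed
  also have "(\<integral>\<^sup>+\<eta>. \<Psi>0 \<eta> \<partial>arrivals m) = ennreal (rate x / total_rate rate)"
    unfolding \<Psi>0_def using i by (rule nn_integral_location_eq)
  also have "ennreal (rate x / total_rate rate) * ennreal (survival B u) * ennreal (survival B u) =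
      ennreal (rate x / total_rate rate * (survival B u * survival B u))"
    using rate_pos[of x] total_rate_pos
    by (simp add: ennreal_mult[symmetric] survival_def mult.assoc)
  also have "survival B u * survival B u = exp (- (2 * sum rate B * u))"
    using u by (simp add: survival_def exp_add[symmetric])
  finally show ?thesis .
qed

text \<open>A request outside the open ball is at distance at least the capped radius and hence more
  than \<open>u\<close>, so only requests inside the ball have to be far in time.\<close>

definition isolated :: "real \<Rightarrow> nat \<Rightarrow> nat \<Rightarrow> (nat \<Rightarrow> 'a \<times> real) \<Rightarrow> real \<Rightarrow> bool" where
  "isolated p m i \<eta> u \<longleftrightarrow> 0 < u \<and> u < capped_radius p (fst (\<eta> i)) \<and>
     (\<forall>j\<in>{..<m} - {i}. fst (\<eta> j) \<in> ball (fst (\<eta> i)) (capped_radius p (fst (\<eta> i))) \<longrightarrow>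
        u < \<bar>(\<Sum>l\<le>i. snd (\<eta> l)) - (\<Sum>l\<le>j. snd (\<eta> l))\<bar>)"

text \<open>Layer-cake form: the isolated levels form an interval starting at 0, and its length
  serves as \<open>Z i\<close> in \<open>opt_lower\<close>. Written as an integral, its expectation
  can be computed level by level.\<close>

definition isolation :: "real \<Rightarrow> nat \<Rightarrow> nat \<Rightarrow> (nat \<Rightarrow> 'a \<times> real) \<Rightarrow> ennreal" where
  "isolation p m i \<eta> = (\<integral>\<^sup>+u. (if isolated p m i \<eta> u then 1 else 0) \<partial>lborel)"

lemma isolation_le:
  assumes "0 \<le> c" "\<And>u. isolated p m i \<eta> u \<Longrightarrow> u < c"
  shows "isolation p m i \<eta> \<le> ennreal c"
proof -
  have "isolation p m i \<eta> \<le> (\<integral>\<^sup>+u. indicator {0<..<c} u \<partial>lborel)"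
    unfolding isolation_def using assms(2)
    by (intro nn_integral_mono) (auto simp: isolated_def split: split_indicator)
  then show ?thesis using assms(1) by simp
qed

lemma isolation_le_opt:
  assumes p: "0 < p"
  shows "(\<Sum>i<m. isolation p m i \<eta>) * ennreal (1 / 2) \<le> ennreal (opt p (request_seq m \<eta>))"
proof -
  define Z where "Z = (\<lambda>i. enn2real (isolation p m i \<eta>))"
  have le_p: "isolation p m i \<eta> \<le> ennreal p" for i
    using p by (intro isolation_le) (auto simp: isolated_def capped_radius_def)
  have Z: "isolation p m i \<eta> = ennreal (Z i)" for i
    unfolding Z_def using le_p[of i] by (simp add: le_less_trans[OF _ ennreal_less_top])
  have Z0: "0 \<le> Z i" for i by (simp add: Z_def)
  have "(\<Sum>i<length (request_seq m \<eta>). Z i / 2) \<le> opt p (request_seq m \<eta>)"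
  proof (rule opt_lower)
    fix i
    show "Z i \<le> p" using le_p[of i] p Z0[of i] by (simp add: Z)
  next
    fix i j assume ij: "i < length (request_seq m \<eta>)" "j < length (request_seq m \<eta>)" "i \<noteq> j"
    let ?c = "dist (fst (\<eta> i)) (fst (\<eta> j)) + \<bar>(\<Sum>l\<le>i. snd (\<eta> l)) - (\<Sum>l\<le>j. snd (\<eta> l))\<bar>"
    have "isolation p m i \<eta> \<le> ennreal ?c"
    proof (rule isolation_le)
      fix u assume u: "isolated p m i \<eta> u"
      \<comment> \<open>Inside the ball the time difference alone exceeds \<open>u\<close>, outside
        it the distance alone.\<close>
      show "u < ?c"
      proof (cases "fst (\<eta> j) \<in> ball (fst (\<eta> i)) (capped_radius p (fst (\<eta> i)))")
        case True
        then have "u < \<bar>(\<Sum>l\<le>i. snd (\<eta> l)) - (\<Sum>l\<le>j. snd (\<eta> l))\<bar>"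
          using u ij by (auto simp: isolated_def)
        then show ?thesis using zero_le_dist[of "fst (\<eta> i)" "fst (\<eta> j)"] by linarith
      next
        case False
        then show ?thesis using u by (auto simp: isolated_def)
      qed
    qed simp
    then have "Z i \<le> ?c"
      unfolding Z by (subst (asm) ennreal_le_iff) auto
    then show "Z i \<le> dist (loc (request_seq m \<eta>) i) (loc (request_seq m \<eta>) j) +
        \<bar>arr (request_seq m \<eta>) i - arr (request_seq m \<eta>) j\<bar>"
      using ij by simp
  qed (use p in simp)
  then have "ennreal (\<Sum>i<m. Z i / 2) \<le> ennreal (opt p (request_seq m \<eta>))"
    by (intro ennreal_leI) simp
  also have "(\<Sum>i<m. Z i / 2) = (\<Sum>i<m. Z i) * (1 / 2)"
    by (simp add: sum_divide_distrib)
  also have "ennreal \<dots> = (\<Sum>i<m. isolation p m i \<eta>) * ennreal (1 / 2)"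
    unfolding Z by (subst ennreal_mult'', simp, subst sum_ennreal) (auto intro: Z0)
  finally show ?thesis .
qed

lemma isolated_measurable:
  assumes i: "i < m"
  shows "Measurable.pred (arrivals m \<Otimes>\<^sub>M lborel) (\<lambda>z. isolated p m i (fst z) (snd z))"
proof -
  have t: "(\<lambda>z. \<Sum>l\<le>j. snd (fst z l)) \<in> borel_measurable (arrivals m \<Otimes>\<^sub>M lborel)" if "j < m" for j
    using that by (intro borel_measurable_sum measurable_compose[OF measurable_fst
        measurable_gap]) auto
  have l: "(\<lambda>z. fst (fst z j)) \<in> measurable (arrivals m \<Otimes>\<^sub>M lborel) (count_space UNIV)" if "j < m"
      for j
    using that by (intro measurable_compose[OF measurable_fst measurable_location])
  note t[OF i, measurable] l[OF i, measurable]
  have [measurable]: "Measurable.pred (arrivals m \<Otimes>\<^sub>M lborel) (\<lambda>z. fst (fst z j) \<in> ball x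
      (capped_radius p x) \<longrightarrow>
        snd z < \<bar>(\<Sum>l\<le>i. snd (fst z l)) - (\<Sum>l\<le>j. snd (fst z l))\<bar>)" if "j \<in> {..<m} - {i}" for j x
  proof -
    have [measurable]: "(\<lambda>z. \<Sum>l\<le>j. snd (fst z l)) \<in> borel_measurable (arrivals m \<Otimes>\<^sub>M lborel)"
      "(\<lambda>z. fst (fst z j)) \<in> measurable (arrivals m \<Otimes>\<^sub>M lborel) (count_space UNIV)"
      using that t l by auto
    show ?thesis by measurable
  qed
  have [measurable]: "Measurable.pred (arrivals m \<Otimes>\<^sub>M lborel) (\<lambda>z. \<forall>j\<in>{..<m} - {i}. fst (fst z j)
      \<in> ball x (capped_radius p x) \<longrightarrow>
        snd z < \<bar>(\<Sum>l\<le>i. snd (fst z l)) - (\<Sum>l\<le>j. snd (fst z l))\<bar>)" for x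
    by (rule pred_intros_finite) auto
  \<comment> \<open>A finite disjunction over the location of request \<open>i\<close> turns the
    random ball into constant ones.\<close>
  have "isolated p m i (fst z) (snd z) \<longleftrightarrow> (\<exists>x\<in>UNIV. fst (fst z i) = x \<and> 0 < snd z \<and> snd z <
      capped_radius p x \<and>
     (\<forall>j\<in>{..<m} - {i}. fst (fst z j) \<in> ball x (capped_radius p x) \<longrightarrow>
        snd z < \<bar>(\<Sum>l\<le>i. snd (fst z l)) - (\<Sum>l\<le>j. snd (fst z l))\<bar>))" for z
    by (simp add: isolated_def)
  then show ?thesis by (simp only:) (rule pred_intros_finite, simp, measurable)
qed

text \<open>The origin of the constant \<open>1 - exp (- 2)\<close>: the survival bound integrated
  over all levels below \<open>r\<close>.\<close>

lemma nn_integral_exp: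
  assumes "0 < r"
  shows "(\<integral>\<^sup>+u. ennreal (exp (- (2 * u / r))) * indicator {0<..<r} u \<partial>lborel) = ennreal (r *
      (1 - exp (- 2)) / 2)"
proof -
  have "AE u in lborel. u \<noteq> 0 \<and> u \<noteq> r"
    using AE_lborel_singleton[of 0] AE_lborel_singleton[of r] by eventually_elim simp
  then have "(\<integral>\<^sup>+u. ennreal (exp (- (2 * u / r))) * indicator {0<..<r} u \<partial>lborel) =
      (\<integral>\<^sup>+u. ennreal (exp (- (2 * u / r))) * indicator {0..r} u \<partial>lborel)"
    by (intro nn_integral_cong_AE, eventually_elim) (auto split: split_indicator)
  also have "\<dots> = ennreal (- (r / 2) * exp (- (2 * r / r)) - (- (r / 2) * exp (- (2 * 0 / r))))"
    using assms by (intro nn_integral_FTC_Icc) (auto intro!: derivative_eq_intros)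
  also have "\<dots> = ennreal (r * (1 - exp (- 2)) / 2)"
    using assms by (simp add: field_simps)
  finally show ?thesis .
qed

text \<open>The path and the level are exchanged by Fubini. For each location,
  \<open>isolated_prob\<close> is applied to the open ball of capped radius, whose rate is bounded
  by \<open>rate_ball_le\<close>.\<close>

lemma isolation_expectation:
  assumes i: "i < m" and p: "0 < p"
  shows "ennreal ((1 - exp (- 2)) / 2 * mean_radius p) \<le> (\<integral>\<^sup>+\<eta>. isolation p m i \<eta> \<partial>arrivals m)"
proof -
  interpret P: pair_sigma_finite "arrivals m" lborel
    by (intro pair_sigma_finite.intro arrivals.sigma_finite_measure_axioms
        lborel.sigma_finite_measure_axioms)
  note [measurable] = isolated_measurable[OF i]
  let ?I = "\<lambda>x \<eta> u. if fst (\<eta> i) = x \<and> (\<forall>j\<in>{..<m} - {i}. fst (\<eta> j) \<in> ball x (capped_radius p x) \<longrightarrow>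
       u < \<bar>(\<Sum>l\<le>i. snd (\<eta> l)) - (\<Sum>l\<le>j. snd (\<eta> l))\<bar>) then 1 else (0::ennreal)"
  let ?c = "\<lambda>x u. ennreal (rate x / total_rate rate) *
    (ennreal (exp (- (2 * u / capped_radius p x))) * indicator {0<..<capped_radius p x} u)"
  have lower: "?c x u \<le> (\<integral>\<^sup>+\<eta>. (if fst (\<eta> i) = x \<and> isolated p m i \<eta> u then 1 else 0) \<partial>arrivals m)"
      for x u
  proof (cases "u \<in> {0<..<capped_radius p x}")
    case True
    have "sum rate (ball x (capped_radius p x)) \<le> 1 / capped_radius p x"
      using p by (intro rate_ball_le capped_radius_pos) (auto simp: capped_radius_def)
    then have "2 * sum rate (ball x (capped_radius p x)) * u \<le> 2 * (1 / capped_radius p x) * u"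
      using True by (intro mult_right_mono mult_left_mono) auto
    then have "?c x u \<le> ennreal (rate x / total_rate rate * exp (- (2 *
        sum rate (ball x (capped_radius p x)) * u)))"
      using True rate_pos[of x] total_rate_pos
      by (auto simp: ennreal_mult[symmetric] intro!: ennreal_leI mult_left_mono divide_right_mono)
    also have "\<dots> \<le> (\<integral>\<^sup>+\<eta>. ?I x \<eta> u \<partial>arrivals m)"
      using True by (intro isolated_prob i) auto
    also have "\<dots> = (\<integral>\<^sup>+\<eta>. (if fst (\<eta> i) = x \<and> isolated p m i \<eta> u then 1 else 0) \<partial>arrivals m)"
      using True by (intro nn_integral_cong) (auto simp: isolated_def)
    finally show ?thesis .
  qed simp
  have meas: "(\<lambda>\<eta>. if fst (\<eta> i) = x \<and> isolated p m i \<eta> u then 1 else (0::ennreal)) \<in>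
      borel_measurable (arrivals m)" for x u
  proof -
    note measurable_location[OF i, measurable]
    have [measurable]: "Measurable.pred (arrivals m) (\<lambda>\<eta>. isolated p m i \<eta> u)"
      using measurable_compose[OF _ isolated_measurable[OF i], of "\<lambda>\<eta>. (\<eta>, u)"] by simp
    show ?thesis by measurable
  qed
  have split: "(if isolated p m i \<eta> u then 1 else (0::ennreal)) =
      (\<Sum>x\<in>UNIV. if fst (\<eta> i) = x \<and> isolated p m i \<eta> u then 1 else 0)" for \<eta> u
    by (cases "isolated p m i \<eta> u") auto
  have "(1 - exp (- 2)) / 2 * mean_radius p =
      (\<Sum>x\<in>UNIV. rate x / total_rate rate * (capped_radius p x * (1 - exp (- 2)) / 2))"
    unfolding mean_radius_def sum_distrib_left by (intro sum.cong) (auto simp: field_simps)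
  also have "ennreal \<dots> =
      (\<Sum>x\<in>UNIV. ennreal (rate x / total_rate rate) * ennreal (capped_radius p x *
          (1 - exp (- 2)) / 2))"
  proof (subst sum_ennreal[symmetric])
    have nn: "0 \<le> rate x / total_rate rate" "0 \<le> capped_radius p x * (1 - exp (- 2)) / 2" for x
      using rate_pos[of x] total_rate_pos capped_radius_pos[OF p, of x] by auto
    show "0 \<le> rate x / total_rate rate * (capped_radius p x * (1 - exp (- 2)) / 2)" for x
      by (intro mult_nonneg_nonneg nn)
    show "(\<Sum>x\<in>UNIV. ennreal (rate x / total_rate rate * (capped_radius p x *
        (1 - exp (- 2)) / 2))) =
        (\<Sum>x\<in>UNIV. ennreal (rate x / total_rate rate) * ennreal (capped_radius p x *
            (1 - exp (- 2)) / 2))"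
      by (intro sum.cong refl ennreal_mult nn)
  qed
  also have "\<dots> = (\<Sum>x\<in>UNIV. \<integral>\<^sup>+u. ?c x u \<partial>lborel)"
    using capped_radius_pos[OF p] by (simp add: nn_integral_cmult nn_integral_exp)
  also have "\<dots> = (\<integral>\<^sup>+u. (\<Sum>x\<in>UNIV. ?c x u) \<partial>lborel)"
    by (rule nn_integral_sum[symmetric]) measurable
  also have "\<dots> \<le> (\<integral>\<^sup>+u. (\<Sum>x\<in>UNIV. \<integral>\<^sup>+\<eta>. (if fst (\<eta> i) = x \<and> isolated p m i \<eta> u then 1 else 0)
      \<partial>arrivals m) \<partial>lborel)"
    by (intro nn_integral_mono sum_mono lower)
  also have "\<dots> = (\<integral>\<^sup>+u. \<integral>\<^sup>+\<eta>. (if isolated p m i \<eta> u then 1 else 0) \<partial>arrivals m \<partial>lborel)"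
    unfolding split using meas by (subst nn_integral_sum) auto
  also have "\<dots> = (\<integral>\<^sup>+\<eta>. isolation p m i \<eta> \<partial>arrivals m)"
    unfolding isolation_def by (rule P.Fubini') (simp add: split_beta, measurable)
  finally show ?thesis .
qed

lemma isolation_measurable:
  assumes "i < m"
  shows "isolation p m i \<in> borel_measurable (arrivals m)"
proof -
  note [measurable] = isolated_measurable[OF assms]
  have "(\<lambda>\<eta>. \<integral>\<^sup>+u. (if isolated p m i \<eta> u then 1 else 0) \<partial>lborel) \<in> borel_measurable (arrivals m)"
    by (rule lborel.borel_measurable_nn_integral) (simp add: split_beta, measurable)
  then show ?thesis by (simp add: isolation_def[abs_def])
qed

text \<open>The 4 is the product of the 2 from sharing a pair's cost and the 2 from the exponential
  integral. \<open>opt\<close> enters only through a pointwise comparison.\<close>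

lemma opt_expectation:
  assumes p: "0 < p"
  shows "ennreal (real m * ((1 - exp (- 2)) / 4 * mean_radius p)) \<le>
      poisson_expectation rate m (opt p)"
proof -
  have "real m * ((1 - exp (- 2)) / 4 * mean_radius p) =
      (\<Sum>i<m. (1 - exp (- 2)) / 2 * mean_radius p) * (1 / 2)"
    by simp
  also have "ennreal \<dots> = (\<Sum>i<m. ennreal ((1 - exp (- 2)) / 2 * mean_radius p)) * ennreal (1 / 2)"
    using mean_radius_pos[OF p] by (subst ennreal_mult'', simp, subst sum_ennreal) auto
  also have "\<dots> \<le> (\<Sum>i<m. \<integral>\<^sup>+\<eta>. isolation p m i \<eta> \<partial>arrivals m) * ennreal (1 / 2)"
    by (intro mult_right_mono sum_mono isolation_expectation p) auto
  also have "\<dots> = (\<integral>\<^sup>+\<eta>. (\<Sum>i<m. isolation p m i \<eta>) * ennreal (1 / 2) \<partial>arrivals m)"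
    by (subst nn_integral_sum[symmetric], rule isolation_measurable, simp)
       (intro nn_integral_multc[symmetric] borel_measurable_sum isolation_measurable, simp)
  also have "\<dots> \<le> poisson_expectation rate m (opt p)"
    unfolding poisson_expectation_def poisson_measure_eq
        by (intro nn_integral_mono isolation_le_opt p)
  finally show ?thesis .
qed

section \<open>Upper bound for the algorithm\<close>

lemma gap_expectation: "(\<integral>\<^sup>+w. ennreal w \<partial>gap_measure) = ennreal (1 / total_rate rate)"
proof -
  have "(\<integral>\<^sup>+w. ennreal w \<partial>gap_measure) =
      (\<integral>\<^sup>+w. ennreal (exponential_density (total_rate rate) w * w ^ 1) \<partial>lborel)"
    unfolding gap_measure_def using total_rate_pos
    by (subst nn_integral_density) (auto intro!: nn_integral_cong simp: ennreal_mult'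
        exponential_density_nonneg)
  also have "\<dots> = ennreal (1 / total_rate rate)"
    using nn_integral_erlang_ith_moment[OF total_rate_pos, of 0 1] by simp
  finally show ?thesis .
qed

lemma AE_gap_nonneg: "AE \<eta> in arrivals m. \<forall>k\<in>{..<m}. 0 \<le> snd (\<eta> k)"
proof (intro AE_finite_allI AE_PiM_component step_prob.prob_space_axioms)
  have "AE w in gap_measure. 0 \<le> w"
    unfolding gap_measure_def by (subst AE_density) (auto simp: exponential_density_def)
  then show "AE y in step_measure. 0 \<le> snd y"
    unfolding step_measure_def by (intro step.AE_pair_measure) auto
qed auto

section \<open>The expected wait until a ball is hit\<close>

lemma miss_measurable:
  assumes "Suc i + n \<le> m"
  shows "(\<lambda>\<eta>. (if fst (\<eta> i) = x then 1 else 0) * (\<Prod>k<n. if fst (\<eta> (Suc i +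
      k)) \<in> B then 0 else (1::ennreal)))
    \<in> borel_measurable (arrivals m)"
proof (intro borel_measurable_times_ennreal borel_measurable_prod_ennreal)
  have *: "(\<lambda>\<eta>. f (fst (\<eta> k))) \<in> borel_measurable (arrivals m)" if "k < m" for k
      and f :: "'a \<Rightarrow> ennreal"
    by (rule measurable_compose[OF measurable_location[OF that]]) simp
  show "(\<lambda>\<eta>. if fst (\<eta> i) = x then 1 else (0::ennreal)) \<in> borel_measurable (arrivals m)"
    using assms by (intro *) simp
  fix k assume "k \<in> {..<n}"
  then show "(\<lambda>\<eta>. if fst (\<eta> (Suc i + k)) \<in> B then 0 else (1::ennreal)) \<in> borel_measurable
      (arrivals m)"
    using assms by (intro *) simp
qed

lemma miss_expectation:
  assumes "Suc i + n \<le> m"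
  shows "(\<integral>\<^sup>+\<eta>. (if fst (\<eta> i) = x then 1 else 0) * (\<Prod>k<n. if fst (\<eta> (Suc i +
      k)) \<in> B then 0 else 1) \<partial>arrivals m) =
    ennreal (rate x / total_rate rate * (1 - sum rate B / total_rate rate) ^ n)"
    (is "(\<integral>\<^sup>+\<eta>. ?\<Psi> n \<eta> \<partial>_) = _")
  using assms
proof (induction n)
  case 0
  then show ?case by (simp add: nn_integral_location_eq)
next
  case (Suc n)
  have "(\<integral>\<^sup>+\<eta>. ?\<Psi> (Suc n) \<eta> \<partial>arrivals m) = (\<integral>\<^sup>+\<eta>. ?\<Psi> n \<eta> * (if fst (\<eta> (Suc i +
      n)) \<in> B then 0 else 1) \<partial>arrivals m)"
    by (simp add: mult.assoc)
  also have "\<dots> = (\<integral>\<^sup>+\<eta>. ?\<Psi> n \<eta> \<partial>arrivals m) *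
      (\<integral>\<^sup>+y. (if y \<in> B then 0 else 1) \<partial>measure_pmf (location_pmf rate))"
    using Suc.prems by (intro nn_integral_mult_location miss_measurable) auto
  also note location_avoid_prob
  also have "(\<integral>\<^sup>+\<eta>. ?\<Psi> n \<eta> \<partial>arrivals m) = ennreal (rate x / total_rate rate *
      (1 - sum rate B / total_rate rate) ^ n)"
    using Suc by simp
  finally show ?case
    using sum_rate_le[of B] rate_pos[of x] total_rate_pos
    by (simp add: ennreal_mult[symmetric] mult_ac)
qed

text \<open>Term \<open>n\<close> is the gap before request \<open>Suc i + n\<close>, counted if the
  \<open>n\<close> requests after \<open>i\<close> all missed \<open>B\<close>. With
  \<open>x\<close> and \<open>B\<close> fixed, each term is a product over independent quantities;
  in \<open>wait\<close> the ball is random.\<close>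

definition miss_wait :: "nat \<Rightarrow> nat \<Rightarrow> 'a \<Rightarrow> 'a set \<Rightarrow> (nat \<Rightarrow> 'a \<times> real) \<Rightarrow> ennreal" where
  "miss_wait m i x B \<eta> = (\<Sum>n<m - Suc i. (if fst (\<eta> i) = x then 1 else 0) *
     (\<Prod>k<n. if fst (\<eta> (Suc i + k)) \<in> B then 0 else 1) * ennreal (snd (\<eta> (Suc i + n))))"

lemma miss_wait_measurable: "miss_wait m i x B \<in> borel_measurable (arrivals m)"
  unfolding miss_wait_def
  by (intro borel_measurable_sum borel_measurable_times_ennreal[OF miss_measurable]
        measurable_compose[OF measurable_gap measurable_ennreal]) auto

text \<open>A gap is independent of the earlier locations that decide whether it counts. With
  hitting probability \<open>q\<close>, this leaves a geometric series with sum at most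
  \<open>1 / q\<close>, times the mean gap \<open>1 / total_rate rate\<close>.\<close>

lemma miss_wait_expectation:
  assumes "B \<noteq> {}"
  shows "(\<integral>\<^sup>+\<eta>. miss_wait m i x B \<eta> \<partial>arrivals m) \<le> ennreal (rate x / total_rate rate *
      (1 / sum rate B))"
proof -
  define q where "q = sum rate B / total_rate rate"
  have B: "0 < sum rate B" using assms rate_pos by (intro sum_pos) auto
  then have q: "0 < q" "q \<le> 1" using total_rate_pos sum_rate_le[of B] by (auto simp: q_def)
  have px: "0 \<le> rate x / total_rate rate" using rate_pos[of x] total_rate_pos by simp
  let ?t = "\<lambda>n. rate x / total_rate rate * (1 - q) ^ n * (1 / total_rate rate)"
  have "(\<integral>\<^sup>+\<eta>. miss_wait m i x B \<eta> \<partial>arrivals m) = (\<Sum>n<m - Suc i. \<integral>\<^sup>+\<eta>. (if fst (\<eta> i) =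
      x then 1 else 0) *
     (\<Prod>k<n. if fst (\<eta> (Suc i + k)) \<in> B then 0 else 1) * ennreal (snd (\<eta> (Suc i + n))) \<partial>arrivals m)"
    unfolding miss_wait_def
    by (intro nn_integral_sum borel_measurable_times_ennreal[OF miss_measurable]
        measurable_compose[OF measurable_gap measurable_ennreal]) auto
  also have "\<dots> = (\<Sum>n<m - Suc i. ennreal (?t n))"
  proof (intro sum.cong refl)
    fix n assume "n \<in> {..<m - Suc i}"
    then have n: "Suc i + n < m" by auto
    have "(\<integral>\<^sup>+\<eta>. (if fst (\<eta> i) = x then 1 else 0) *
        (\<Prod>k<n. if fst (\<eta> (Suc i + k)) \<in> B then 0 else 1) * ennreal (snd (\<eta> (Suc i + n)))
            \<partial>arrivals m) =
        (\<integral>\<^sup>+\<eta>. (if fst (\<eta> i) = x then 1 else 0) * (\<Prod>k<n. if fst (\<eta> (Suc i + k)) \<in> B then 0 else 1)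
            \<partial>arrivals m) *
        (\<integral>\<^sup>+w. ennreal w \<partial>gap_measure)"
      by (rule nn_integral_mult_gap[OF n miss_measurable[OF less_imp_le[OF n]]]) auto
    also have "\<dots> = ennreal (rate x / total_rate rate * (1 - q) ^ n) * ennreal (1 / total_rate rate)"
      unfolding gap_expectation q_def by (subst miss_expectation) (use n in auto)
    also have "\<dots> = ennreal (?t n)"
      using total_rate_pos by (intro ennreal_mult''[symmetric]) simp
    finally show "(\<integral>\<^sup>+\<eta>. (if fst (\<eta> i) = x then 1 else 0) *
        (\<Prod>k<n. if fst (\<eta> (Suc i + k)) \<in> B then 0 else 1) * ennreal (snd (\<eta> (Suc i + n)))
            \<partial>arrivals m) = ennreal (?t n)" .
  qed
  also have "\<dots> = ennreal (\<Sum>n<m - Suc i. ?t n)"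
    using px q total_rate_pos by (intro sum_ennreal mult_nonneg_nonneg) auto
  also have "\<dots> \<le> ennreal (rate x / total_rate rate * (1 / sum rate B))"
  proof (rule ennreal_leI)
    let ?N = "m - Suc i"
    have "1 - (1 - q) ^ ?N = (1 - (1 - q)) * (\<Sum>n<?N. (1 - q) ^ n)" by (rule one_diff_power_eq)
    moreover have "0 \<le> (1 - q) ^ ?N" using q by simp
    ultimately have "q * (\<Sum>n<?N. (1 - q) ^ n) \<le> 1" by simp
    then have "(\<Sum>n<?N. (1 - q) ^ n) \<le> 1 / q" using q by (simp add: field_simps)
    then have "rate x / total_rate rate * (1 / total_rate rate) * (\<Sum>n<?N. (1 - q) ^ n) \<le>
        rate x / total_rate rate * (1 / total_rate rate) * (1 / q)"
      using rate_pos[of x] total_rate_pos by (intro mult_left_mono) (auto simp: less_imp_le)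
    also have "rate x / total_rate rate * (1 / total_rate rate) * (1 / q) =
        rate x / total_rate rate * (1 / sum rate B)"
      using total_rate_pos B by (simp add: q_def)
    finally show "(\<Sum>n<?N. ?t n) \<le> rate x / total_rate rate * (1 / sum rate B)"
      by (simp add: sum_distrib_left mult_ac)
  qed
  finally show ?thesis .
qed

lemma wait_le_miss_wait:
  assumes i: "i < m" and \<eta>: "\<forall>k\<in>{..<m}. 0 \<le> snd (\<eta> k)"
  shows "ennreal (wait rate (request_seq m \<eta>) i) \<le>
    miss_wait m i (fst (\<eta> i)) (cball (fst (\<eta> i)) (radius rate (fst (\<eta> i)))) \<eta>"
proof -
  define B where "B = cball (fst (\<eta> i)) (radius rate (fst (\<eta> i)))"
  let ?\<sigma> = "request_seq m \<eta>"
  have "wait rate ?\<sigma> i = (\<Sum>k\<in>{i<..<m}. if \<forall>j\<in>{i<..<k}. fst (\<eta> j) \<notin> B then snd (\<eta> k) else 0)"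
    unfolding wait_def length_request_seq
  proof (intro sum.cong refl)
    fix k assume k: "k \<in> {i<..<m}"
    then obtain k' where k': "k = Suc k'" by (cases k) auto
    then have "arr ?\<sigma> k - arr ?\<sigma> (k - 1) = snd (\<eta> k)" using k by simp
    moreover have "(\<forall>j\<in>{i<..<k}. loc ?\<sigma> j \<notin> cball (loc ?\<sigma> i) (radius rate (loc ?\<sigma> i))) \<longleftrightarrow>
        (\<forall>j\<in>{i<..<k}. fst (\<eta> j) \<notin> B)"
      using k i by (intro ball_cong) (auto simp: B_def)
    ultimately show "(if \<forall>j\<in>{i<..<k}. loc ?\<sigma> j \<notin> cball (loc ?\<sigma> i) (radius rate (loc ?\<sigma> i))
       then arr ?\<sigma> k - arr ?\<sigma> (k - 1) else 0) =
           (if \<forall>j\<in>{i<..<k}. fst (\<eta> j) \<notin> B then snd (\<eta> k) else 0)"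
      by simp
  qed
  also have "\<dots> = (\<Sum>n<m - Suc i. if \<forall>j\<in>{i<..<Suc i + n}. fst (\<eta> j) \<notin> B then snd (\<eta> (Suc i +
      n)) else 0)"
  proof (rule sum.reindex_bij_betw[symmetric])
    show "bij_betw ((+) (Suc i)) {..<m - Suc i} {i<..<m}"
      by (rule bij_betwI[where g = "\<lambda>k. k - Suc i"]) auto
  qed
  also have "ennreal \<dots> = (\<Sum>n<m - Suc i. ennreal (if \<forall>j\<in>{i<..<Suc i +
      n}. fst (\<eta> j) \<notin> B then snd (\<eta> (Suc i + n)) else 0))"
    using \<eta> by (intro sum_ennreal[symmetric]) auto
  also have "\<dots> \<le> miss_wait m i (fst (\<eta> i)) B \<eta>"
    unfolding miss_wait_def
  proof (rule sum_mono)
    fix n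
    show "ennreal (if \<forall>j\<in>{i<..<Suc i + n}. fst (\<eta> j) \<notin> B then snd (\<eta> (Suc i + n)) else 0) \<le>
      (if fst (\<eta> i) = fst (\<eta> i) then 1 else 0) *
     (\<Prod>k<n. if fst (\<eta> (Suc i + k)) \<in> B then 0 else 1) * ennreal (snd (\<eta> (Suc i + n)))"
    proof (cases "\<forall>j\<in>{i<..<Suc i + n}. fst (\<eta> j) \<notin> B")
      case True
      then have "(\<Prod>k<n. if fst (\<eta> (Suc i + k)) \<in> B then 0 else (1::ennreal)) = 1"
        by (intro prod.neutral) auto
      then show ?thesis using True by simp
    next
      case False
      then show ?thesis by (simp only: if_False) simp
    qed
  qed
  finally show ?thesis by (simp add: B_def)
qed

text \<open>One summand per possible location \<open>x\<close>, so that the ball no longer depends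
  on the path. In the second class the capped radius is \<open>p\<close> and no wait is
  charged.\<close>

definition charge_bound :: "real \<Rightarrow> nat \<Rightarrow> nat \<Rightarrow> (nat \<Rightarrow> 'a \<times> real) \<Rightarrow> 'a \<Rightarrow> ennreal" where
  "charge_bound p m i \<eta> x =
     ennreal (capped_radius p x) * (if fst (\<eta> i) = x then 1 else 0) +
     (if x \<in> points2 rate p then 0 else miss_wait m i x (cball x (radius rate x)) \<eta>)"

lemma chronological_request_seq:
  assumes "\<forall>k\<in>{..<m}. 0 \<le> snd (\<eta> k)"
  shows "chronological (request_seq m \<eta>)"
  using assms by (auto simp: chronological_def)

lemma charge_le:
  assumes i: "i < m" and \<eta>: "\<forall>k\<in>{..<m}. 0 \<le> snd (\<eta> k)" and p: "0 < p"
  shows "ennreal (charge rate p (request_seq m \<eta>) i) \<le> (\<Sum>x\<in>UNIV. charge_bound p m i \<eta> x)"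
proof -
  let ?x = "fst (\<eta> i)"
  have "ennreal (charge rate p (request_seq m \<eta>) i) \<le> charge_bound p m i \<eta> ?x"
  proof (cases "?x \<in> points2 rate p")
    case True
    then have "charge rate p (request_seq m \<eta>) i = capped_radius p ?x"
      using i by (simp add: charge_def capped_radius_def points2_def)
    then show ?thesis using True by (simp add: charge_bound_def)
  next
    case False
    then have "charge rate p (request_seq m \<eta>) i = capped_radius p ?x +
        wait rate (request_seq m \<eta>) i"
      using i by (simp add: charge_def capped_radius_def points2_def)
    then have "ennreal (charge rate p (request_seq m \<eta>) i) = ennreal (capped_radius p ?x) +
        ennreal (wait rate (request_seq m \<eta>) i)"
      using capped_radius_pos[OF p, of ?x] wait_nonneg[OF chronological_request_seq[OF \<eta>]] by simp
    also have "\<dots> \<le> charge_bound p m i \<eta> ?x"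
      using False wait_le_miss_wait[OF i \<eta>] by (simp add: charge_bound_def add_left_mono)
    finally show ?thesis .
  qed
  also have "\<dots> \<le> (\<Sum>x\<in>UNIV. charge_bound p m i \<eta> x)"
    by (rule member_le_sum) auto
  finally show ?thesis .
qed

lemma location_eq_measurable:
  "i < m \<Longrightarrow> (\<lambda>\<eta>. if fst (\<eta> i) = x then 1 else (0::ennreal)) \<in> borel_measurable (arrivals m)"
  by (rule measurable_compose[OF measurable_location]) auto

lemma charge_bound_measurable:
  assumes i: "i < m"
  shows "(\<lambda>\<eta>. charge_bound p m i \<eta> x) \<in> borel_measurable (arrivals m)"
proof -
  note [measurable] = miss_wait_measurable location_eq_measurable[OF i]
  show ?thesis unfolding charge_bound_def by measurable
qed

text \<open>The 2 counts the radius once for the connection and once for the wait, whose mean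
  \<open>1 / sum rate ?B\<close> is at most the radius by the definition of
  \<open>radius\<close>.\<close>

lemma charge_bound_expectation:
  assumes i: "i < m" and p: "0 < p"
  shows "(\<integral>\<^sup>+\<eta>. charge_bound p m i \<eta> x \<partial>arrivals m) \<le>
    ennreal (2 * (rate x / total_rate rate * capped_radius p x))"
proof -
  note [measurable] = miss_wait_measurable location_eq_measurable[OF i]
  let ?B = "cball x (radius rate x)"
  have px: "0 \<le> rate x / total_rate rate" using rate_pos[of x] total_rate_pos by simp
  have r: "0 \<le> capped_radius p x" using capped_radius_pos[OF p, of x] by simp
  have "(\<integral>\<^sup>+\<eta>. charge_bound p m i \<eta> x \<partial>arrivals m) =
      ennreal (capped_radius p x) * ennreal (rate x / total_rate rate) +
      (if x \<in> points2 rate p then 0 else \<integral>\<^sup>+\<eta>. miss_wait m i x ?B \<eta> \<partial>arrivals m)"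
    unfolding charge_bound_def using nn_integral_location_eq[OF i, of x]
    by (simp add: nn_integral_add nn_integral_cmult)
  also have "\<dots> \<le> ennreal (capped_radius p x) * ennreal (rate x / total_rate rate) +
      ennreal (rate x / total_rate rate * capped_radius p x)"
  proof (intro add_left_mono)
    show "(if x \<in> points2 rate p then 0 else \<integral>\<^sup>+\<eta>. miss_wait m i x ?B \<eta> \<partial>arrivals m) \<le>
      ennreal (rate x / total_rate rate * capped_radius p x)"
    proof (cases "x \<in> points2 rate p")
      case False
      then have "capped_radius p x = radius rate x" by (simp add: capped_radius_def points2_def)
      moreover have "?B \<noteq> {}" using radius_pos[of x] by (auto simp: less_imp_le)
      then have "(\<integral>\<^sup>+\<eta>. miss_wait m i x ?B \<eta> \<partial>arrivals m) \<le> ennreal (rate x / total_rate rate *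
          (1 / sum rate ?B))"
        by (rule miss_wait_expectation)
      moreover have "rate x / total_rate rate * (1 / sum rate ?B) \<le> rate x / total_rate rate *
          radius rate x"
        using px radius_minimum(2)[of rate x, OF rate_pos] by (intro mult_left_mono) auto
      ultimately show ?thesis using False by (auto intro: order_trans ennreal_leI)
    qed simp
  qed
  also have "\<dots> = ennreal (2 * (rate x / total_rate rate * capped_radius p x))"
  proof -
    have "ennreal (capped_radius p x) * ennreal (rate x / total_rate rate) =
        ennreal (rate x / total_rate rate * capped_radius p x)"
      using px r by (subst ennreal_mult[symmetric]) (auto simp: mult.commute)
    moreover have "0 \<le> rate x / total_rate rate * capped_radius p x" using px r
        by (rule mult_nonneg_nonneg)
    ultimately show ?thesis by (simp only: mult_2 ennreal_plus)
  qed
  finally show ?thesis .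
qed

lemma alg_expectation:
  fixes tie :: "'a request list \<Rightarrow> nat set \<Rightarrow> nat"
  assumes p: "0 < p" and tie: "tie_rule tie" and fin: "final_rule fin"
  defines "C \<equiv> p + real CARD('a) * diameter (UNIV :: 'a set)"
  shows "poisson_expectation rate m (alg rate p tie fin) \<le> ennreal (real m * (2 * mean_radius p) +
      C)"
proof -
  have C: "0 \<le> C"
    using p diameter_ge_0[of "UNIV :: 'a set"] by (simp add: C_def finite_imp_bounded)
  have mr: "0 \<le> mean_radius p" using mean_radius_pos[OF p] by simp
  \<comment> \<open>Nonnegative gaps make the sequence chronological almost surely. On
    \<open>alg\<close> only the monotonicity of the integral is used; everything that is split or
    exchanged below is measurable.\<close>
  have "poisson_expectation rate m (alg rate p tie fin) \<le>
      (\<integral>\<^sup>+\<eta>. (\<Sum>i<m. \<Sum>x\<in>UNIV. charge_bound p m i \<eta> x) + ennreal C \<partial>arrivals m)"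
    unfolding poisson_expectation_def poisson_measure_eq
  proof (intro nn_integral_mono_AE eventually_mono[OF AE_gap_nonneg])
    fix \<eta> :: "nat \<Rightarrow> 'a \<times> real"
    assume \<eta>: "\<forall>k\<in>{..<m}. 0 \<le> snd (\<eta> k)"
    let ?\<sigma> = "request_seq m \<eta>"
    have \<sigma>: "chronological ?\<sigma>" using \<eta> by (rule chronological_request_seq)
    have ch: "0 \<le> charge rate p ?\<sigma> i" for i
      using p radius_pos wait_nonneg[OF \<sigma>, of rate i]
          by (simp add: charge_def less_imp_le add_nonneg_nonneg)
    have "ennreal (alg rate p tie fin ?\<sigma>) \<le> ennreal ((\<Sum>i<m. charge rate p ?\<sigma> i) + C)"
      using alg_upper[OF rate_pos p tie fin \<sigma>] by (intro ennreal_leI) (simp add: C_def)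
    also have "\<dots> = (\<Sum>i<m. ennreal (charge rate p ?\<sigma> i)) + ennreal C"
      using ch C by (simp add: sum_nonneg)
    also have "\<dots> \<le> (\<Sum>i<m. \<Sum>x\<in>UNIV. charge_bound p m i \<eta> x) + ennreal C"
      using charge_le[OF _ \<eta> p] by (intro add_right_mono sum_mono) auto
    finally show "ennreal (alg rate p tie fin ?\<sigma>) \<le> (\<Sum>i<m. \<Sum>x\<in>UNIV. charge_bound p m i \<eta> x) +
        ennreal C" .
  qed
  also have "\<dots> = (\<Sum>i<m. \<Sum>x\<in>UNIV. \<integral>\<^sup>+\<eta>. charge_bound p m i \<eta> x \<partial>arrivals m) + ennreal C"
  proof -
    have "(\<lambda>\<eta>. \<Sum>i<m. \<Sum>x\<in>UNIV. charge_bound p m i \<eta> x) \<in> borel_measurable (arrivals m)"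
      by (intro borel_measurable_sum charge_bound_measurable) simp
    then have "(\<integral>\<^sup>+\<eta>. (\<Sum>i<m. \<Sum>x\<in>UNIV. charge_bound p m i \<eta> x) + ennreal C \<partial>arrivals m) =
        (\<integral>\<^sup>+\<eta>. (\<Sum>i<m. \<Sum>x\<in>UNIV. charge_bound p m i \<eta> x) \<partial>arrivals m) + ennreal C"
      by (simp add: nn_integral_add arrivals.emeasure_space_1)
    also have "(\<integral>\<^sup>+\<eta>. (\<Sum>i<m. \<Sum>x\<in>UNIV. charge_bound p m i \<eta> x) \<partial>arrivals m) =
        (\<Sum>i<m. \<integral>\<^sup>+\<eta>. (\<Sum>x\<in>UNIV. charge_bound p m i \<eta> x) \<partial>arrivals m)"
      by (intro nn_integral_sum borel_measurable_sum charge_bound_measurable) simp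
    also have "\<dots> = (\<Sum>i<m. \<Sum>x\<in>UNIV. \<integral>\<^sup>+\<eta>. charge_bound p m i \<eta> x \<partial>arrivals m)"
      by (intro sum.cong refl nn_integral_sum charge_bound_measurable) simp
    finally show ?thesis .
  qed
  also have "\<dots> \<le> (\<Sum>i<m. \<Sum>x\<in>UNIV. ennreal (2 * (rate x / total_rate rate * capped_radius p x))) +
      ennreal C"
    using p by (intro add_right_mono sum_mono charge_bound_expectation) auto
  also have "(\<Sum>x\<in>UNIV. ennreal (2 * (rate x / total_rate rate * capped_radius p x))) =
      ennreal (2 * mean_radius p)"
    unfolding mean_radius_def sum_distrib_left
    using rate_pos total_rate_pos capped_radius_pos[OF p]
    by (intro sum_ennreal) (auto intro!: mult_nonneg_nonneg divide_nonneg_nonneg simp: less_imp_le)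
  also have "(\<Sum>i<m. ennreal (2 * mean_radius p)) + ennreal C = ennreal (real m * (2 *
      mean_radius p) + C)"
    using mr C by (subst sum_ennreal) auto
  finally show ?thesis .
qed

end

section \<open>The limit of the ratio of expectations\<close>

theorem theorem4:
  fixes rate :: "'a::{finite, metric_space} \<Rightarrow> real"
    and p :: real
    and tie :: "'a request list \<Rightarrow> nat set \<Rightarrow> nat"
    and fin :: "'a request list \<Rightarrow> nat set \<Rightarrow> (nat \<times> nat) set"
  assumes "\<And>x. 0 < rate x"
    and "0 < p"
    and "tie_rule tie"
    and "final_rule fin"
  shows "limsup (\<lambda>m. poisson_expectation rate m (alg rate p tie fin) /
           poisson_expectation rate m (opt p)) \<le> ennreal (8 / (1 - exp (- 2)))"
proof -
  interpret poisson_arrivals rate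
    using assms(1) by unfold_locales
  define C where "C = p + real CARD('a) * diameter (UNIV :: 'a set)"
  define s where "s = mean_radius p"
  define c where "c = (1 - exp (- 2 :: real)) / 4"
  have s: "0 < s" unfolding s_def using assms(2) by (rule mean_radius_pos)
  have c: "0 < c" by (simp add: c_def)
  have C: "0 \<le> C"
    using assms(2) diameter_ge_0[of "UNIV :: 'a set"] by (simp add: C_def finite_imp_bounded)
  let ?r = "\<lambda>m. poisson_expectation rate m (alg rate p tie fin) / poisson_expectation rate m (opt p)"
  \<comment> \<open>The quotient of the two bounds, \<open>(2 * s * m + C) / (c * s * m)\<close>;
    its limit \<open>2 / c\<close> is the claimed constant.\<close>
  let ?b = "\<lambda>m. 2 / c + C / (c * s) * (1 / real m)"
  have bound: "?r m \<le> ennreal (?b m)" if m: "0 < m" for m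
  proof -
    have opt: "ennreal (real m * (c * s)) \<le> poisson_expectation rate m (opt p)"
      using opt_expectation[OF assms(2), of m] by (simp add: c_def s_def)
    have "0 < ennreal (real m * (c * s))" using m s c by simp
    \<comment> \<open>Rules out the degenerate division by zero in \<open>ennreal\<close>.\<close>
    then have pos: "0 < poisson_expectation rate m (opt p)" using opt by (rule less_le_trans)
    have "poisson_expectation rate m (alg rate p tie fin) \<le> ennreal (real m * (2 * s) + C)"
      unfolding C_def s_def by (rule alg_expectation[OF assms(2-4)])
    also have "real m * (2 * s) + C = real m * (c * s) * ?b m"
      using m s c by (simp add: field_simps)
    also have "ennreal \<dots> = ennreal (real m * (c * s)) * ennreal (?b m)"
      using s c C by (intro ennreal_mult) auto
    also have "\<dots> \<le> poisson_expectation rate m (opt p) * ennreal (?b m)"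
      using opt by (rule mult_right_mono) simp
    finally show ?thesis using pos by (intro divide_le_posI_ennreal)
  qed
  have "limsup ?r \<le> limsup (\<lambda>m. ennreal (?b m))"
    using bound by (intro Limsup_mono eventually_sequentiallyI[of 1]) auto
  also have "(\<lambda>m. ?b m) \<longlonglongrightarrow> 2 / c + C / (c * s) * 0"
    by (intro tendsto_intros lim_1_over_n)
  then have "(\<lambda>m. ennreal (?b m)) \<longlonglongrightarrow> ennreal (2 / c + C / (c * s) * 0)"
    by (rule tendsto_ennrealI)
  then have "limsup (\<lambda>m. ennreal (?b m)) = ennreal (2 / c + C / (c * s) * 0)"
    by (intro lim_imp_Limsup) auto
  also have "2 / c + C / (c * s) * 0 = 8 / (1 - exp (- 2))"
    by (simp add: c_def)
  finally show ?thesis .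
qed

end
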